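(* Every catalytic quantum map $\Phi$ on a finite-dimensional system $A$ is factorizable.
   Context: All systems $A$, $B$ have finite-dimensional Hilbert spaces. A quantum map is a completely positive trace-preserving linear map. A quantum map $\Phi$ on $A$ is called catalytic if there exist a finite-dimensional system $B$, a quantum state $\sigma_B$ on $B$ (the catalyst), a unitary $U$ on $\mathcal{H}_A\otimes\mathcal{H}_B$ and a unitary $V$ on $\mathcal{H}_B$ such that for all states $\rho$ on $A$: $\mathrm{Tr}_B\,U(\rho_A\otimes\sigma_B)U^\dagger=\Phi(\rho)$ and $\mathrm{Tr}_A\,U(\rho_A\otimes\sigma_B)U^\dagger=V\sigma_BV^\dagger$. A unital quantum map $\Phi$ on the algebra $M_d$ of operators on a $d$-dimensional Hilbert space is called factorizable if there exist a (possibly infinite-dimensional) von Neumann algebra $N$ with a faithful normal tracial state $\tau_N$ and a unitary $u\in M_d\otimes N$ such that $\Phi(x)=(\mathrm{id}_{M_d}\otimes\tau_N)\big(u(x\otimes 1_N)u^*\big)$ for all $x\in M_d$. *)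

theory Defs
  imports
    "HOL-Analysis.Infinite_Sum"
    "HOL-Analysis.Function_Topology"
    "Jordan_Normal_Form.Schur_Decomposition"
begin

section \<open>Finite-dimensional quantum systems\<close>

text \<open>
  An operator on an n-dimensional Hilbert space is a matrix in \<^term>\<open>carrier_mat n n\<close>.
  On a tensor product of spaces of dimensions m and n, the basis vector
  $e_a \otimes e_b$ has index a * n + b.
\<close>

definition trace_mat :: "complex mat \<Rightarrow> complex" where
  "trace_mat A = (\<Sum>i<dim_row A. A $$ (i, i))"

text \<open>The order on \<^typ>\<open>complex\<close> is that of Complex_Order: \<open>0 \<le> z\<close> means
  that z is real and nonnegative.\<close>

definition psd :: "nat \<Rightarrow> complex mat \<Rightarrow> bool" where
  "psd n A \<longleftrightarrow> A \<in> carrier_mat n n \<and> (\<forall>v \<in> carrier_vec n. 0 \<le> (A *\<^sub>v v) \<bullet>c v)"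

definition quantum_state :: "nat \<Rightarrow> complex mat \<Rightarrow> bool" where
  "quantum_state n \<rho> \<longleftrightarrow> psd n \<rho> \<and> trace_mat \<rho> = 1"

definition unitary_mat :: "nat \<Rightarrow> complex mat \<Rightarrow> bool" where
  "unitary_mat n U \<longleftrightarrow> U \<in> carrier_mat n n \<and>
     U * mat_adjoint U = 1\<^sub>m n \<and> mat_adjoint U * U = 1\<^sub>m n"

definition kron :: "complex mat \<Rightarrow> complex mat \<Rightarrow> complex mat" where
  "kron A B = mat (dim_row A * dim_row B) (dim_col A * dim_col B)
     (\<lambda>(i, j). A $$ (i div dim_row B, j div dim_col B) * B $$ (i mod dim_row B, j mod dim_col B))"

text \<open>Partial traces over the second (B, dimension n) and the first (A, dimension m) factor.\<close>

definition ptrace_B :: "nat \<Rightarrow> nat \<Rightarrow> complex mat \<Rightarrow> complex mat" where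
  "ptrace_B m n X = mat m m (\<lambda>(i, j). \<Sum>b<n. X $$ (i * n + b, j * n + b))"

definition ptrace_A :: "nat \<Rightarrow> nat \<Rightarrow> complex mat \<Rightarrow> complex mat" where
  "ptrace_A m n X = mat n n (\<lambda>(i, j). \<Sum>a<m. X $$ (a * n + i, a * n + j))"

text \<open>The map $\mathrm{id}_k \otimes \Phi$ applies \<open>\<Phi>\<close> to each of the \<open>k * k\<close> blocks of size
  \<open>d * d\<close>.\<close>

definition mat_block :: "nat \<Rightarrow> complex mat \<Rightarrow> nat \<Rightarrow> nat \<Rightarrow> complex mat" where
  "mat_block d X p q = mat d d (\<lambda>(i, j). X $$ (p * d + i, q * d + j))"

definition id_tensor_map ::
  "nat \<Rightarrow> nat \<Rightarrow> (complex mat \<Rightarrow> complex mat) \<Rightarrow> complex mat \<Rightarrow> complex mat" where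
  "id_tensor_map k d \<Phi> X = mat (k * d) (k * d)
     (\<lambda>(i, j). \<Phi> (mat_block d X (i div d) (j div d)) $$ (i mod d, j mod d))"

definition linear_map_mat :: "nat \<Rightarrow> (complex mat \<Rightarrow> complex mat) \<Rightarrow> bool" where
  "linear_map_mat d \<Phi> \<longleftrightarrow>
     (\<forall>X \<in> carrier_mat d d. \<Phi> X \<in> carrier_mat d d) \<and>
     (\<forall>X \<in> carrier_mat d d. \<forall>Y \<in> carrier_mat d d. \<Phi> (X + Y) = \<Phi> X + \<Phi> Y) \<and>
     (\<forall>c. \<forall>X \<in> carrier_mat d d. \<Phi> (c \<cdot>\<^sub>m X) = c \<cdot>\<^sub>m \<Phi> X)"

definition completely_positive :: "nat \<Rightarrow> (complex mat \<Rightarrow> complex mat) \<Rightarrow> bool" where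
  "completely_positive d \<Phi> \<longleftrightarrow>
     (\<forall>k X. psd (k * d) X \<longrightarrow> psd (k * d) (id_tensor_map k d \<Phi> X))"

definition trace_preserving :: "nat \<Rightarrow> (complex mat \<Rightarrow> complex mat) \<Rightarrow> bool" where
  "trace_preserving d \<Phi> \<longleftrightarrow> (\<forall>X \<in> carrier_mat d d. trace_mat (\<Phi> X) = trace_mat X)"

definition quantum_map :: "nat \<Rightarrow> (complex mat \<Rightarrow> complex mat) \<Rightarrow> bool" where
  "quantum_map d \<Phi> \<longleftrightarrow> linear_map_mat d \<Phi> \<and> completely_positive d \<Phi> \<and> trace_preserving d \<Phi>"

definition catalytic :: "nat \<Rightarrow> (complex mat \<Rightarrow> complex mat) \<Rightarrow> bool" where
  "catalytic d \<Phi> \<longleftrightarrow> quantum_map d \<Phi> \<and>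
     (\<exists>n \<sigma> U V. quantum_state n \<sigma> \<and> unitary_mat (d * n) U \<and> unitary_mat n V \<and>
       (\<forall>\<rho>. quantum_state d \<rho> \<longrightarrow>
          ptrace_B d n (U * kron \<rho> \<sigma> * mat_adjoint U) = \<Phi> \<rho> \<and>
          ptrace_A d n (U * kron \<rho> \<sigma> * mat_adjoint U) = V * \<sigma> * mat_adjoint V))"


section \<open>Von Neumann algebras\<close>

text \<open>
  Up to unitary equivalence every Hilbert space is $\ell^2(J)$ for some index set J (finite or
  infinite).  Vectors are functions vanishing outside J.  Bounded operators are functions on
  vectors, extended by 0 outside $\ell^2(J)$ so that equality of operators is equality of
  functions.
\<close>

definition ell2 :: "'i set \<Rightarrow> ('i \<Rightarrow> complex) set" where
  "ell2 J = {x. (\<forall>i. i \<notin> J \<longrightarrow> x i = 0) \<and> (\<lambda>i. (cmod (x i))\<^sup>2) summable_on UNIV}"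

definition ell2_inner :: "('i \<Rightarrow> complex) \<Rightarrow> ('i \<Rightarrow> complex) \<Rightarrow> complex" where
  "ell2_inner x y = infsum (\<lambda>i. cnj (x i) * y i) UNIV"

definition ell2_norm :: "('i \<Rightarrow> complex) \<Rightarrow> real" where
  "ell2_norm x = sqrt (infsum (\<lambda>i. (cmod (x i))\<^sup>2) UNIV)"

type_synonym 'i op = "('i \<Rightarrow> complex) \<Rightarrow> ('i \<Rightarrow> complex)"

definition op_one :: "'i set \<Rightarrow> 'i op" where
  "op_one J = (\<lambda>x. if x \<in> ell2 J then x else (\<lambda>i. 0))"

definition op_zero :: "'i op" where
  "op_zero = (\<lambda>x i. 0)"

definition op_add :: "'i op \<Rightarrow> 'i op \<Rightarrow> 'i op" where
  "op_add S T = (\<lambda>x i. S x i + T x i)"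

definition op_sum :: "('k \<Rightarrow> 'i op) \<Rightarrow> 'k set \<Rightarrow> 'i op" where
  "op_sum F K = (\<lambda>x i. \<Sum>k\<in>K. F k x i)"

definition op_scale :: "complex \<Rightarrow> 'i op \<Rightarrow> 'i op" where
  "op_scale c T = (\<lambda>x i. c * T x i)"

definition bounded_ops :: "'i set \<Rightarrow> 'i op set" where
  "bounded_ops J = {T.
     (\<forall>x \<in> ell2 J. T x \<in> ell2 J) \<and>
     (\<forall>x. x \<notin> ell2 J \<longrightarrow> T x = (\<lambda>i. 0)) \<and>
     (\<forall>x \<in> ell2 J. \<forall>y \<in> ell2 J. T (\<lambda>i. x i + y i) = (\<lambda>i. T x i + T y i)) \<and>
     (\<forall>c. \<forall>x \<in> ell2 J. T (\<lambda>i. c * x i) = (\<lambda>i. c * T x i)) \<and>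
     (\<exists>K. \<forall>x \<in> ell2 J. ell2_norm (T x) \<le> K * ell2_norm x)}"

definition op_adjoint :: "'i set \<Rightarrow> 'i op \<Rightarrow> 'i op" where
  "op_adjoint J T = (THE S. S \<in> bounded_ops J \<and>
     (\<forall>x \<in> ell2 J. \<forall>y \<in> ell2 J. ell2_inner (S x) y = ell2_inner x (T y)))"

definition weak_operator_topology :: "'i set \<Rightarrow> 'i op topology" where
  "weak_operator_topology J =
     pullback_topology (bounded_ops J)
       (\<lambda>T. \<lambda>(x, y) \<in> ell2 J \<times> ell2 J. ell2_inner x (T y))
       (product_topology (\<lambda>_. euclidean) (ell2 J \<times> ell2 J))"

definition von_neumann_algebra :: "'i set \<Rightarrow> 'i op set \<Rightarrow> bool" where
  "von_neumann_algebra J N \<longleftrightarrow>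
     N \<subseteq> bounded_ops J \<and>
     op_one J \<in> N \<and>
     (\<forall>S \<in> N. \<forall>T \<in> N. op_add S T \<in> N) \<and>
     (\<forall>c. \<forall>T \<in> N. op_scale c T \<in> N) \<and>
     (\<forall>S \<in> N. \<forall>T \<in> N. S \<circ> T \<in> N) \<and>
     (\<forall>T \<in> N. op_adjoint J T \<in> N) \<and>
     closedin (weak_operator_topology J) N"

definition self_adjoint_part :: "'i set \<Rightarrow> 'i op set \<Rightarrow> 'i op set" where
  "self_adjoint_part J N = {T \<in> N. op_adjoint J T = T}"

definition op_le :: "'i set \<Rightarrow> 'i op \<Rightarrow> 'i op \<Rightarrow> bool" where
  "op_le J S T \<longleftrightarrow> (\<forall>x \<in> ell2 J. ell2_inner x (S x) \<le> ell2_inner x (T x))"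

definition op_lub :: "'i set \<Rightarrow> 'i op set \<Rightarrow> 'i op set \<Rightarrow> 'i op \<Rightarrow> bool" where
  "op_lub J N D a \<longleftrightarrow> a \<in> self_adjoint_part J N \<and> (\<forall>b \<in> D. op_le J b a) \<and>
     (\<forall>c \<in> self_adjoint_part J N. (\<forall>b \<in> D. op_le J b c) \<longrightarrow> op_le J a c)"

definition op_directed :: "'i set \<Rightarrow> 'i op set \<Rightarrow> bool" where
  "op_directed J D \<longleftrightarrow> D \<noteq> {} \<and> (\<forall>a \<in> D. \<forall>b \<in> D. \<exists>c \<in> D. op_le J a c \<and> op_le J b c)"

definition state_on :: "'i set \<Rightarrow> 'i op set \<Rightarrow> ('i op \<Rightarrow> complex) \<Rightarrow> bool" where
  "state_on J N \<tau> \<longleftrightarrow>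
     (\<forall>S \<in> N. \<forall>T \<in> N. \<tau> (op_add S T) = \<tau> S + \<tau> T) \<and>
     (\<forall>c. \<forall>T \<in> N. \<tau> (op_scale c T) = c * \<tau> T) \<and>
     (\<forall>T \<in> N. 0 \<le> \<tau> (op_adjoint J T \<circ> T)) \<and>
     \<tau> (op_one J) = 1"

definition tracial_on :: "'i op set \<Rightarrow> ('i op \<Rightarrow> complex) \<Rightarrow> bool" where
  "tracial_on N \<tau> \<longleftrightarrow> (\<forall>S \<in> N. \<forall>T \<in> N. \<tau> (S \<circ> T) = \<tau> (T \<circ> S))"

definition faithful_on :: "'i set \<Rightarrow> 'i op set \<Rightarrow> ('i op \<Rightarrow> complex) \<Rightarrow> bool" where
  "faithful_on J N \<tau> \<longleftrightarrow> (\<forall>T \<in> N. \<tau> (op_adjoint J T \<circ> T) = 0 \<longrightarrow> T = op_zero)"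

text \<open>Normality: the state preserves suprema of bounded increasing nets of self-adjoint elements.
  The supremum is one of reals, as a state is real on self-adjoint elements.\<close>

definition normal_on :: "'i set \<Rightarrow> 'i op set \<Rightarrow> ('i op \<Rightarrow> complex) \<Rightarrow> bool" where
  "normal_on J N \<tau> \<longleftrightarrow>
     (\<forall>D a. D \<subseteq> self_adjoint_part J N \<and> op_directed J D \<and> op_lub J N D a \<longrightarrow>
        (SUP b\<in>D. Re (\<tau> b)) = Re (\<tau> a))"

definition faithful_normal_tracial_state :: "'i set \<Rightarrow> 'i op set \<Rightarrow> ('i op \<Rightarrow> complex) \<Rightarrow> bool" where
  "faithful_normal_tracial_state J N \<tau> \<longleftrightarrow>
     state_on J N \<tau> \<and> tracial_on N \<tau> \<and> faithful_on J N \<tau> \<and> normal_on J N \<tau>"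


section \<open>Factorizable maps\<close>

text \<open>
  $M_d \otimes N$ is identified with the d by d matrices with entries in N, the matrix with
  entries $a_{ij}$ standing for $\sum_{i,j} e_{ij} \otimes a_{ij}$.  The algebraic tensor product
  is already a von Neumann algebra, as $M_d$ is finite-dimensional.  Under this identification
  $\mathrm{id}_{M_d} \otimes \tau$ is the entrywise map \<^term>\<open>map_mat \<tau>\<close>.  Products of matrix
  entries are compositions of operators, so the library's product of matrices does not apply.
\<close>

definition tensor_carrier :: "nat \<Rightarrow> 'i op set \<Rightarrow> 'i op mat set" where
  "tensor_carrier d N = {u \<in> carrier_mat d d. \<forall>i<d. \<forall>j<d. u $$ (i, j) \<in> N}"

definition tensor_mult :: "nat \<Rightarrow> 'i op mat \<Rightarrow> 'i op mat \<Rightarrow> 'i op mat" where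
  "tensor_mult d u v = mat d d (\<lambda>(i, j). op_sum (\<lambda>k. u $$ (i, k) \<circ> v $$ (k, j)) {..<d})"

definition tensor_adjoint :: "'i set \<Rightarrow> nat \<Rightarrow> 'i op mat \<Rightarrow> 'i op mat" where
  "tensor_adjoint J d u = mat d d (\<lambda>(i, j). op_adjoint J (u $$ (j, i)))"

text \<open>The element $x \otimes 1_N$.\<close>

definition tensor_embed :: "'i set \<Rightarrow> nat \<Rightarrow> complex mat \<Rightarrow> 'i op mat" where
  "tensor_embed J d x = mat d d (\<lambda>(i, j). op_scale (x $$ (i, j)) (op_one J))"

definition tensor_unitary :: "'i set \<Rightarrow> nat \<Rightarrow> 'i op set \<Rightarrow> 'i op mat \<Rightarrow> bool" where
  "tensor_unitary J d N u \<longleftrightarrow> u \<in> tensor_carrier d N \<and>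
     tensor_mult d u (tensor_adjoint J d u) = tensor_embed J d (1\<^sub>m d) \<and>
     tensor_mult d (tensor_adjoint J d u) u = tensor_embed J d (1\<^sub>m d)"

text \<open>
  HOL cannot quantify existentially over types, so the universe of the index sets J has to be
  fixed.  Subsets of \<^typ>\<open>nat\<close> give all separable Hilbert spaces, which loses nothing: the von
  Neumann subalgebra of N generated by the entries of u and their adjoints contains all the data,
  and its GNS representation for the faithful normal state \<open>\<tau>\<close> is faithful, normal and acts
  on a separable space.
\<close>

definition factorizable :: "nat \<Rightarrow> (complex mat \<Rightarrow> complex mat) \<Rightarrow> bool" where
  "factorizable d \<Phi> \<longleftrightarrow> quantum_map d \<Phi> \<and> \<Phi> (1\<^sub>m d) = 1\<^sub>m d \<and>
     (\<exists>(J :: nat set) N \<tau> u.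
        von_neumann_algebra J N \<and> faithful_normal_tracial_state J N \<tau> \<and>
        tensor_unitary J d N u \<and>
        (\<forall>x \<in> carrier_mat d d. \<Phi> x =
           map_mat \<tau> (tensor_mult d (tensor_mult d u (tensor_embed J d x)) (tensor_adjoint J d u))))"

end

theory Submission
  imports Defs "HOL-Analysis.L2_Norm" "Jordan_Normal_Form.Spectral_Radius"
begin

text \<open>
  After absorbing \<open>V\<close> and a diagonalisation of the catalyst into the unitary, the catalyst is
  diagonal with entries \<open>l r\<close>, and conjugation by the unitary \<open>W\<close> takes \<open>1 \<otimes> D\<close> to an
  operator whose second marginal is still proportional to \<open>D\<close>. A Hilbert-Schmidt norm computation
  then shows that \<open>W\<close> commutes with \<open>1 \<otimes> D\<close>. So \<open>W\<close> restricts to the support of \<open>D\<close> and there has entries in the algebra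
  \<open>N\<close> of block diagonal matrices, one block for each nonzero eigenvalue. On \<open>N\<close> the functional
  \<open>T \<mapsto> tr (D T)\<close> is a faithful trace, and \<open>W\<close> and this trace represent \<open>\<Phi>\<close>.
\<close>

section \<open>Matrices and unitary diagonalisation\<close>

text \<open>Why the Hilbert-Schmidt computation closes: by unitarity both square terms in the norm
  of the commutator of \<open>W\<close> with 1 tensor D equal d tr(D^2). The cross term is tr((1
  tensor D) Y), where Y is the conjugate of 1 tensor D by \<open>W\<close>; it sees only the second
  marginal of Y, which is d D, so it has the same value and the norm is zero. Why commutation gives
  a factorization: it moves D out of the conjugation, so the partial trace over B of W (rho tensor
  D) W-adjoint is that of (1 tensor D) W (rho tensor 1) W-adjoint. This is id tensor tr(D .) applied
  to a conjugate of rho tensor 1. On the support of D, \<open>N\<close> is the commutant of D. Hence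
  D is central in \<open>N\<close>, which makes tr(D .) a trace, and D has no kernel there, which
  makes it faithful. Blocks belong to eigenvalues, not to eigenvectors, because commutation only
  kills coefficients between distinct eigenvalues. \<open>N\<close> acts on a finite-dimensional
  space, so nearly everything reduces to finite sums. The exception is normality: it concerns
  arbitrary directed sets and needs a limit.\<close>

lemma index_mat_adjoint [simp]:
  "i < dim_col A \<Longrightarrow> j < dim_row A \<Longrightarrow> mat_adjoint A $$ (i, j) = conjugate (A $$ (j, i))"
  by (simp add: mat_adjoint_def mat_of_rows_index)

lemma dim_mat_adjoint [simp]:
  "dim_row (mat_adjoint A) = dim_col A" "dim_col (mat_adjoint A) = dim_row A"
  by (simp_all add: mat_adjoint_def)

lemma mat_adjoint_carrier [simp, intro]:
  "A \<in> carrier_mat n m \<Longrightarrow> mat_adjoint A \<in> carrier_mat m n"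
  by (metis carrier_matD carrier_matI dim_mat_adjoint)

lemma mat_adjoint_adjoint [simp]: "mat_adjoint (mat_adjoint (A :: complex mat)) = A"
  by (rule eq_matI) auto

lemma index_mat_mult_sum:
  "A \<in> carrier_mat n m \<Longrightarrow> B \<in> carrier_mat m k \<Longrightarrow> i < n \<Longrightarrow> j < k \<Longrightarrow>
   (A * B) $$ (i, j) = (\<Sum>l<m. A $$ (i, l) * B $$ (l, j))"
  by (simp add: scalar_prod_def lessThan_atLeast0)

lemma mat_adjoint_mult:
  fixes A B :: "complex mat"
  assumes "A \<in> carrier_mat n m" "B \<in> carrier_mat m k"
  shows "mat_adjoint (A * B) = mat_adjoint B * mat_adjoint A"
proof (rule eq_matI)
  fix i j assume "i < dim_row (mat_adjoint B * mat_adjoint A)"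
    and "j < dim_col (mat_adjoint B * mat_adjoint A)"
  then have ij: "i < k" "j < n" using assms by auto
  have "mat_adjoint (A * B) $$ (i, j) = cnj ((A * B) $$ (j, i))"
    using assms ij by (subst index_mat_adjoint) auto
  also have "\<dots> = (\<Sum>l<m. mat_adjoint B $$ (i, l) * mat_adjoint A $$ (l, j))"
    using assms ij by (simp add: index_mat_mult_sum[OF assms] mult.commute del: index_mult_mat)
  also have "\<dots> = (mat_adjoint B * mat_adjoint A) $$ (i, j)"
    using assms ij by (subst index_mat_mult_sum) auto
  finally show "mat_adjoint (A * B) $$ (i, j) = (mat_adjoint B * mat_adjoint A) $$ (i, j)" .
qed (use assms in auto)

lemma mult_square_carrier: "A \<in> carrier_mat n n \<Longrightarrow> B \<in> carrier_mat n n \<Longrightarrow> A * B \<in> carrier_mat n n"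
  by (rule mult_carrier_mat)

lemma mat_adjoint_one [simp]: "mat_adjoint (1\<^sub>m n :: complex mat) = 1\<^sub>m n"
  by (rule eq_matI) auto

lemma assoc_mult_square:
  fixes A B C :: "complex mat"
  shows "A \<in> carrier_mat n n \<Longrightarrow> B \<in> carrier_mat n n \<Longrightarrow> C \<in> carrier_mat n n \<Longrightarrow> A * B * C = A * (B * C)"
  by (rule assoc_mult_mat)

lemma unitary_mat_mult:
  assumes "unitary_mat n U" "unitary_mat n V"
  shows "unitary_mat n (U * V)"
proof -
  have c: "U \<in> carrier_mat n n" "V \<in> carrier_mat n n"
    using assms by (auto simp: unitary_mat_def)
  note c' = c c[THEN mat_adjoint_carrier]
  have "(U * V) * mat_adjoint (U * V) = U * (V * mat_adjoint V) * mat_adjoint U"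
    using c' by (simp add: mat_adjoint_mult[OF c] assoc_mult_square[of _ n] mult_square_carrier[of _ n])
  moreover have "mat_adjoint (U * V) * (U * V) = mat_adjoint V * (mat_adjoint U * U) * V"
    using c' by (simp add: mat_adjoint_mult[OF c] assoc_mult_square[of _ n] mult_square_carrier[of _ n])
  ultimately show ?thesis
    using assms c' by (simp add: unitary_mat_def)
qed

lemma unitary_mat_adjoint: "unitary_mat n U \<Longrightarrow> unitary_mat n (mat_adjoint U)"
  by (auto simp: unitary_mat_def)

section \<open>Spectral theorem for Hermitian matrices by deflation\<close>

lemma unitary_mat_first_col:
  fixes v :: "complex vec"
  assumes v: "v \<in> carrier_vec n" and v0: "v \<noteq> 0\<^sub>v n"
  obtains W c where "unitary_mat n W" "col W 0 = c \<cdot>\<^sub>v v"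
proof -
  interpret cof_vec_space n "TYPE(complex)" .
  have n: "n > 0" using v v0 by (cases n) auto
  define b where "b = basis_completion v"
  note b = basis_completion[OF v v0, folded b_def]
  define ws where "ws = gram_schmidt n b"
  note ws = gram_schmidt_result[OF b(2) b(4) b(5) ws_def]
  obtain vs where bv: "b = v # vs" using b(6,7) n by (cases b) auto
  have hd: "hd ws = v" using gram_schmidt_hd[OF v, of vs] by (simp add: ws_def bv)
  have len: "length ws = n" using ws(4) b(6) by simp
  \<comment> \<open>Gram-Schmidt keeps \<open>v\<close> at the head of the list but yields vectors
    that are orthogonal, not normalised; \<open>s\<close> rescales each to norm one. The constant
    \<open>c\<close> of the conclusion is therefore \<open>s v\<close>.\<close>
  define s where "s w = complex_of_real (1 / sqrt (Re (w \<bullet>c w)))" for w :: "complex vec"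
  define W where "W = mat_of_cols n (map (\<lambda>w. s w \<cdot>\<^sub>v w) ws)"
  have W: "W \<in> carrier_mat n n" using len by (auto simp: W_def)
  have wsc: "ws ! i \<in> carrier_vec n" if "i < n" for i using that len ws(3) by auto
  have colW: "col W i = s (ws ! i) \<cdot>\<^sub>v ws ! i" if "i < n" for i
    using that len wsc[OF that] by (simp add: W_def)
  have "mat_adjoint W * W = 1\<^sub>m n"
  proof (rule eq_matI)
    fix i j assume "i < dim_row (1\<^sub>m n :: complex mat)" "j < dim_col (1\<^sub>m n :: complex mat)"
    then have ij: "i < n" "j < n" by auto
    have "(mat_adjoint W * W) $$ (i, j) = (\<Sum>l<n. cnj (W $$ (l, i)) * W $$ (l, j))"
      using ij W by (subst index_mat_mult_sum[of _ n n]) auto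
    also have "\<dots> = (\<Sum>l<n. cnj (col W i $ l) * (col W j $ l))"
      using ij W by auto
    also have "\<dots> = (\<Sum>l<n. s (ws ! i) * s (ws ! j) * (ws ! j $ l * cnj (ws ! i $ l)))"
      unfolding colW[OF ij(1)] colW[OF ij(2)]
      using wsc[OF ij(1)] wsc[OF ij(2)] by (intro sum.cong refl) (simp add: s_def)
    also have "\<dots> = s (ws ! i) * s (ws ! j) * (ws ! j \<bullet>c ws ! i)"
      using ij wsc[of i] wsc[of j]
      by (simp add: sum_distrib_left scalar_prod_def lessThan_atLeast0)
    also have "\<dots> = 1\<^sub>m n $$ (i, j)"
    proof (cases "i = j")
      case True
      have ne: "ws ! i \<bullet>c ws ! i \<noteq> 0" using corthogonalD[OF ws(2)] ij len by auto
      have "ws ! i \<bullet>c ws ! i \<ge> 0" by (rule conjugate_square_ge_0_vec)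
      then have eq: "ws ! i \<bullet>c ws ! i = of_real (Re (ws ! i \<bullet>c ws ! i))"
        and ge: "Re (ws ! i \<bullet>c ws ! i) \<ge> 0"
        by (auto simp: less_eq_complex_def complex_eq_iff)
      then have gt: "Re (ws ! i \<bullet>c ws ! i) > 0" using ne
        by (metis less_eq_real_def of_real_0)
      have "s (ws ! i) * s (ws ! i) * (ws ! i \<bullet>c ws ! i) = 1"
        unfolding s_def by (subst eq, unfold of_real_mult[symmetric]) (use gt in simp)
      then show ?thesis using True ij by simp
    next
      case False
      then show ?thesis using corthogonalD[OF ws(2), of j i] ij len by auto
    qed
    finally show "(mat_adjoint W * W) $$ (i, j) = 1\<^sub>m n $$ (i, j)" .
  qed (use W in auto)
  moreover from this have "W * mat_adjoint W = 1\<^sub>m n"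
    using mat_mult_left_right_inverse[OF mat_adjoint_carrier[OF W] W] by simp
  ultimately have "unitary_mat n W" using W by (simp add: unitary_mat_def)
  moreover have "col W 0 = s v \<cdot>\<^sub>v v"
    using colW[of 0] n hd len by (cases ws) auto
  ultimately show ?thesis using that by blast
qed

lemma unitary_mat_four_block:
  assumes "unitary_mat n Q"
  shows "unitary_mat (Suc n) (four_block_mat (1\<^sub>m 1) (0\<^sub>m 1 n) (0\<^sub>m n 1) Q)" (is "unitary_mat _ ?F")
proof -
  have Q: "Q \<in> carrier_mat n n" "mat_adjoint Q \<in> carrier_mat n n"
    using assms by (auto simp: unitary_mat_def)
  have adj: "mat_adjoint ?F = four_block_mat (1\<^sub>m 1) (0\<^sub>m 1 n) (0\<^sub>m n 1) (mat_adjoint Q)"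
    using Q by (intro eq_matI) auto
  have "?F * mat_adjoint ?F = 1\<^sub>m (Suc n)" "mat_adjoint ?F * ?F = 1\<^sub>m (Suc n)"
    unfolding adj using assms Q
    by (simp_all add: mult_four_block_mat[of _ 1 1 _ n _ n _ _ 1 _ n] unitary_mat_def)
  moreover have "?F \<in> carrier_mat (Suc n) (Suc n)"
    using four_block_carrier_mat[of "1\<^sub>m 1" 1 1 Q n n] Q by simp
  ultimately show ?thesis by (simp add: unitary_mat_def)
qed

text \<open>Induction on the dimension. Rotating an eigenvector into the first column makes that
  column a multiple of the first unit vector; Hermitian symmetry then clears the first row as well,
  and the remaining block is Hermitian of size \<open>n\<close>. Reality of the diagonal is left
  open here and obtained for states from positivity.\<close>

theorem hermitian_unitary_diagonalisation:
  fixes A :: "complex mat"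
  assumes "A \<in> carrier_mat n n" "mat_adjoint A = A"
  shows "\<exists>Q \<mu>. unitary_mat n Q \<and> mat_adjoint Q * A * Q = mat_diag n \<mu>"
  using assms
proof (induction n arbitrary: A)
  case 0
  then have "unitary_mat 0 (1\<^sub>m 0) \<and> mat_adjoint (1\<^sub>m 0) * A * 1\<^sub>m 0 = mat_diag 0 (\<lambda>_. 0)"
    by (auto simp: unitary_mat_def mat_diag_def intro!: eq_matI)
  then show ?case by blast
next
  case (Suc n)
  note A = Suc.prems(1)
  obtain e where "eigenvalue A e"
    using spectrum_non_empty[OF A] by (auto simp: spectrum_def)
  then obtain v where "eigenvector A v e" by (auto simp: eigenvalue_def)
  then have v: "v \<in> carrier_vec (Suc n)" "v \<noteq> 0\<^sub>v (Suc n)" "A *\<^sub>v v = e \<cdot>\<^sub>v v"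
    using A by (auto simp: eigenvector_def)
  obtain W c where WU: "unitary_mat (Suc n) W" and Wc: "col W 0 = c \<cdot>\<^sub>v v"
    using unitary_mat_first_col[OF v(1,2)] .
  have W: "W \<in> carrier_mat (Suc n) (Suc n)" "mat_adjoint W \<in> carrier_mat (Suc n) (Suc n)"
    using WU by (auto simp: unitary_mat_def)
  define A' where "A' = mat_adjoint W * A * W"
  have A': "A' \<in> carrier_mat (Suc n) (Suc n)" using W A by (auto simp: A'_def)
  have adjA': "mat_adjoint A' = A'"
    using W A Suc.prems(2)
    by (simp add: A'_def mat_adjoint_mult[of _ "Suc n" "Suc n" _ "Suc n"] assoc_mult_square[of _ "Suc n"] mult_square_carrier[of _ "Suc n"])
  have "A' = mat_adjoint W * (A * W)" using W A by (simp add: A'_def assoc_mult_square[of _ "Suc n"])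
  then have "col A' 0 = mat_adjoint W *\<^sub>v (A *\<^sub>v col W 0)"
    using col_mult2[OF W(2) mult_square_carrier[OF A W(1)], of 0] col_mult2[OF A W(1), of 0] by (metis zero_less_Suc)
  also have "A *\<^sub>v col W 0 = e \<cdot>\<^sub>v col W 0"
    using A v by (simp add: Wc mult_mat_vec[of _ "Suc n" "Suc n"] smult_smult_assoc mult.commute)
  also have "mat_adjoint W *\<^sub>v (e \<cdot>\<^sub>v col W 0) = e \<cdot>\<^sub>v col (mat_adjoint W * W) 0"
    using mult_mat_vec[OF W(2), of "col W 0" e] col_mult2[OF W(2) W(1), of 0] W
    by (metis col_dim carrier_matD(1) zero_less_Suc)
  also have "\<dots> = e \<cdot>\<^sub>v unit_vec (Suc n) 0"
    using WU by (simp add: unitary_mat_def)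
  finally have col0: "col A' 0 = e \<cdot>\<^sub>v unit_vec (Suc n) 0" .
  have c0: "A' $$ (i, 0) = (if i = 0 then e else 0)" if "i < Suc n" for i
    using arg_cong[OF col0, of "\<lambda>x. x $ i"] that A' by auto
  have r0: "A' $$ (0, i) = 0" if "i < Suc n" "i \<noteq> 0" for i
    using index_mat_adjoint[of 0 A' i] that A' c0[of i] by (simp add: adjA')
  define B where "B = mat n n (\<lambda>(i, j). A' $$ (Suc i, Suc j))"
  have B: "B \<in> carrier_mat n n" by (simp add: B_def)
  have "mat_adjoint B = B"
  proof (rule eq_matI)
    fix i j assume "i < dim_row B" "j < dim_col B"
    then show "mat_adjoint B $$ (i, j) = B $$ (i, j)"
      using index_mat_adjoint[of "Suc i" A' "Suc j"] A' B adjA' by (simp add: B_def)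
  qed (use B in auto)
  then obtain P \<mu> where P: "unitary_mat n P" "mat_adjoint P * B * P = mat_diag n \<mu>"
    using Suc.IH[OF B] by blast
  have Pc: "P \<in> carrier_mat n n" "mat_adjoint P \<in> carrier_mat n n"
    using P by (auto simp: unitary_mat_def)
  define F where "F = four_block_mat (1\<^sub>m 1) (0\<^sub>m 1 n) (0\<^sub>m n 1) P"
  have FU: "unitary_mat (Suc n) F" using unitary_mat_four_block[OF P(1)] by (simp add: F_def)
  then have F: "F \<in> carrier_mat (Suc n) (Suc n)" "mat_adjoint F \<in> carrier_mat (Suc n) (Suc n)"
    by (auto simp: unitary_mat_def)
  have adj: "mat_adjoint F = four_block_mat (1\<^sub>m 1) (0\<^sub>m 1 n) (0\<^sub>m n 1) (mat_adjoint P)"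
    using Pc unfolding F_def by (intro eq_matI) auto
  define E where "E = mat 1 1 (\<lambda>_. e)"
  have E: "E \<in> carrier_mat 1 1" by (simp add: E_def)
  have A'_eq: "A' = four_block_mat E (0\<^sub>m 1 n) (0\<^sub>m n 1) B"
    using A' c0 r0 by (intro eq_matI) (auto simp: B_def E_def)
  have "mat_adjoint F * A' * F = four_block_mat E (0\<^sub>m 1 n) (0\<^sub>m n 1) (mat_adjoint P * B * P)"
    unfolding adj unfolding A'_eq F_def using Pc B E mult_square_carrier[OF Pc(2) B]
    by (simp add: mult_four_block_mat[of _ 1 1 _ n _ n _ _ 1 _ n])
  also have "\<dots> = mat_diag (Suc n) (\<lambda>i. case i of 0 \<Rightarrow> e | Suc i \<Rightarrow> \<mu> i)"
    unfolding P(2) by (intro eq_matI) (auto simp: E_def mat_diag_def split: nat.splits)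
  finally have "mat_adjoint F * A' * F = mat_diag (Suc n) (\<lambda>i. case i of 0 \<Rightarrow> e | Suc i \<Rightarrow> \<mu> i)" .
  moreover have "mat_adjoint (W * F) * A * (W * F) = mat_adjoint F * A' * F"
    using W F A by (simp add: A'_def mat_adjoint_mult[of _ "Suc n" "Suc n" _ "Suc n"] assoc_mult_square[of _ "Suc n"] mult_square_carrier[of _ "Suc n"])
  ultimately show ?case using unitary_mat_mult[OF WU FU] by metis
qed

section \<open>Operators on a finite-dimensional l2 space\<close>

text \<open>The index set is an arbitrary \<open>J\<close>, not an initial segment, because it will
  be the support of the catalyst's spectrum. The guards give the value 0 outside
  \<open>ell2 J\<close> and off \<open>J\<close>, as \<open>bounded_ops\<close> prescribes, so equal
  matrices on \<open>J\<close> give equal functions.\<close>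

definition mat_op :: "'i set \<Rightarrow> ('i \<Rightarrow> 'i \<Rightarrow> complex) \<Rightarrow> 'i op" where
  "mat_op J f = (\<lambda>x i. if x \<in> ell2 J \<and> i \<in> J then \<Sum>j\<in>J. f i j * x j else 0)"

definition basis_vec :: "'i \<Rightarrow> 'i \<Rightarrow> complex" where
  "basis_vec j = (\<lambda>i. if i = j then 1 else 0)"

definition op_entry :: "'i op \<Rightarrow> 'i \<Rightarrow> 'i \<Rightarrow> complex" where
  "op_entry T i j = T (basis_vec j) i"

text \<open>For finite \<open>J\<close> this is the commutant of the diagonal operator with entries
  \<open>l\<close>: commuting with it means that (l i - l j) times the entry at i, j is
  zero.\<close>

definition block_algebra :: "'i set \<Rightarrow> ('i \<Rightarrow> real) \<Rightarrow> 'i op set" where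
  "block_algebra J l = {T \<in> bounded_ops J. \<forall>i\<in>J. \<forall>j\<in>J. l i \<noteq> l j \<longrightarrow> op_entry T i j = 0}"

definition weighted_trace :: "'i set \<Rightarrow> ('i \<Rightarrow> real) \<Rightarrow> 'i op \<Rightarrow> complex" where
  "weighted_trace J l T = (\<Sum>i\<in>J. of_real (l i) * op_entry T i i)"

lemma sum_if_eq: 
  fixes f :: "'i \<Rightarrow> complex"
  assumes "finite J" "j \<in> J"
  shows "(\<Sum>i\<in>J. f i * (if i = j then 1 else 0)) = f j"
    and "(\<Sum>i\<in>J. (if i = j then 1 else 0) * f i) = f j"
proof -
  show "(\<Sum>i\<in>J. f i * (if i = j then 1 else 0)) = f j"
    using sum.delta[OF assms(1), of j f] assms(2) by (simp add: if_distrib cong: if_cong)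
  then show "(\<Sum>i\<in>J. (if i = j then 1 else 0) * f i) = f j"
    by (simp add: mult.commute)
qed

context
  fixes J :: "'i set"
  assumes fin: "finite J"
begin

section \<open>Bounded operators on a finite index set as matrices\<close>

lemma ell2_finite_iff: "x \<in> ell2 J \<longleftrightarrow> (\<forall>i. i \<notin> J \<longrightarrow> x i = 0)"
proof -
  have "(\<lambda>i. (cmod (x i))\<^sup>2) summable_on UNIV" if "\<forall>i. i \<notin> J \<longrightarrow> x i = 0"
    using that fin by (subst summable_on_cong_neutral[of J UNIV _ "\<lambda>i. (cmod (x i))\<^sup>2"]) auto
  then show ?thesis by (auto simp: ell2_def)
qed

lemma ell2_outside: "x \<in> ell2 J \<Longrightarrow> i \<notin> J \<Longrightarrow> x i = 0"
  by (simp add: ell2_finite_iff)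

lemma basis_vec_ell2: "j \<in> J \<Longrightarrow> basis_vec j \<in> ell2 J"
  by (auto simp: ell2_finite_iff basis_vec_def)

lemma ell2_inner_finite: 
  assumes "x \<in> ell2 J" 
  shows "ell2_inner x y = (\<Sum>i\<in>J. cnj (x i) * y i)"
proof -
  have "ell2_inner x y = infsum (\<lambda>i. cnj (x i) * y i) J"
    unfolding ell2_inner_def using ell2_outside[OF assms] by (intro infsum_cong_neutral) auto
  then show ?thesis using fin by simp
qed

lemma ell2_norm_finite: 
  assumes "x \<in> ell2 J" 
  shows "ell2_norm x = L2_set (\<lambda>i. cmod (x i)) J"
proof -
  have "infsum (\<lambda>i. (cmod (x i))\<^sup>2) UNIV = infsum (\<lambda>i. (cmod (x i))\<^sup>2) J"
    using ell2_outside[OF assms] by (intro infsum_cong_neutral) auto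
  then show ?thesis using fin by (simp add: ell2_norm_def L2_set_def)
qed

lemma mat_op_apply: "x \<in> ell2 J \<Longrightarrow> i \<in> J \<Longrightarrow> mat_op J f x i = (\<Sum>j\<in>J. f i j * x j)"
  by (simp add: mat_op_def)

lemma op_entry_mat_op:
  assumes "i \<in> J" "j \<in> J"
  shows "op_entry (mat_op J f) i j = f i j"
  using assms sum_if_eq(1)[OF fin, of j "f i"]
  by (simp add: op_entry_def mat_op_apply basis_vec_ell2) (simp add: basis_vec_def)

lemma mat_op_eqI: "(\<And>i j. i \<in> J \<Longrightarrow> j \<in> J \<Longrightarrow> f i j = g i j) \<Longrightarrow> mat_op J f = mat_op J g"
  by (auto simp: mat_op_def fun_eq_iff intro!: sum.cong)

lemma mat_op_ell2: "mat_op J f x \<in> ell2 J"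
  by (auto simp: ell2_finite_iff mat_op_def)

lemma mat_op_bounded: "mat_op J f \<in> bounded_ops J"
proof -
  \<comment> \<open>A crude bound suffices: the l2 norm is at most the l1 norm, and each coordinate
    of \<open>x\<close> is at most the norm of \<open>x\<close>.\<close>
  have "ell2_norm (mat_op J f x) \<le> (\<Sum>i\<in>J. \<Sum>j\<in>J. cmod (f i j)) * ell2_norm x"
    if x: "x \<in> ell2 J" for x
  proof -
    have "ell2_norm (mat_op J f x) \<le> (\<Sum>i\<in>J. cmod (mat_op J f x i))"
      unfolding ell2_norm_finite[OF mat_op_ell2] by (rule L2_set_le_sum) auto
    also have "\<dots> \<le> (\<Sum>i\<in>J. \<Sum>j\<in>J. cmod (f i j) * ell2_norm x)"
    proof (rule sum_mono)
      fix i assume i: "i \<in> J"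
      have "cmod (mat_op J f x i) \<le> (\<Sum>j\<in>J. cmod (f i j * x j))"
        unfolding mat_op_apply[OF x i] by (rule norm_sum)
      also have "\<dots> \<le> (\<Sum>j\<in>J. cmod (f i j) * ell2_norm x)"
        unfolding ell2_norm_finite[OF x] norm_mult
        by (intro sum_mono mult_left_mono member_le_L2_set fin) auto
      finally show "cmod (mat_op J f x i) \<le> (\<Sum>j\<in>J. cmod (f i j) * ell2_norm x)" .
    qed
    finally show ?thesis by (simp add: sum_distrib_right)
  qed
  moreover have "mat_op J f (\<lambda>i. x i + y i) = (\<lambda>i. mat_op J f x i + mat_op J f y i)"
    if "x \<in> ell2 J" "y \<in> ell2 J" for x y
  proof -
    have "(\<lambda>i. x i + y i) \<in> ell2 J" using that by (auto simp: ell2_finite_iff)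
    then show ?thesis using that by (auto simp: mat_op_def algebra_simps sum.distrib)
  qed
  moreover have "mat_op J f (\<lambda>i. c * x i) = (\<lambda>i. c * mat_op J f x i)"
    if "x \<in> ell2 J" for x c
  proof -
    have "(\<lambda>i. c * x i) \<in> ell2 J" using that by (auto simp: ell2_finite_iff)
    then show ?thesis using that by (auto simp: mat_op_def algebra_simps sum_distrib_left)
  qed
  moreover have "mat_op J f x = (\<lambda>i. 0)" if "x \<notin> ell2 J" for x
    using that by (simp add: mat_op_def)
  ultimately show ?thesis
    unfolding bounded_ops_def using mat_op_ell2 by blast
qed

text \<open>Expanding \<open>x\<close> in the finite basis and using linearity determines the
  operator from its entries; outside \<open>ell2 J\<close> both sides vanish. From here on,
  identities between operators can be checked entry by entry.\<close>

lemma bounded_op_eq_mat_op: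
  assumes T: "T \<in> bounded_ops J"
  shows "T = mat_op J (op_entry T)"
proof -
  have add: "T (\<lambda>i. x i + y i) = (\<lambda>i. T x i + T y i)" if "x \<in> ell2 J" "y \<in> ell2 J" for x y
    using T that by (simp add: bounded_ops_def)
  have scale: "T (\<lambda>i. c * x i) = (\<lambda>i. c * T x i)" if "x \<in> ell2 J" for x c
    using T that by (simp add: bounded_ops_def)
  have sum: "T (\<lambda>i. \<Sum>j\<in>K. x j * basis_vec j i) = (\<lambda>i. \<Sum>j\<in>K. x j * T (basis_vec j) i)"
    if "finite K" "K \<subseteq> J" for K x
    using that
  proof (induction K)
    case empty
    have "(\<lambda>i. 0) \<in> ell2 J" by (simp add: ell2_finite_iff)
    \<comment> \<open>The empty sum needs that the zero vector is sent to zero, which is homogeneity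
      with the scalar 0.\<close>
    from scale[OF this, of 0] show ?case by simp
  next
    case (insert k K)
    have "(\<lambda>i. \<Sum>j\<in>K. x j * basis_vec j i) \<in> ell2 J" "(\<lambda>i. x k * basis_vec k i) \<in> ell2 J"
      using insert.prems by (auto simp: ell2_finite_iff basis_vec_def intro!: sum.neutral)
    then show ?case
      using insert add scale[OF basis_vec_ell2[of k]] by simp
  qed
  have "T x i = mat_op J (op_entry T) x i" for x i
  proof (cases "x \<in> ell2 J")
    case True
    have "x = (\<lambda>i. \<Sum>j\<in>J. x j * basis_vec j i)"
    proof
      fix i show "x i = (\<Sum>j\<in>J. x j * basis_vec j i)"
      proof (cases "i \<in> J")
        case i: True
        have "(\<Sum>j\<in>J. x j * basis_vec j i) = (\<Sum>j\<in>J. x j * (if j = i then 1 else 0))"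
          by (intro sum.cong) (auto simp: basis_vec_def)
        then show ?thesis using sum_if_eq(1)[OF fin i, of x] by simp
      next
        case False
        then show ?thesis using True by (auto simp: ell2_outside basis_vec_def intro!: sum.neutral)
      qed
    qed
    then have "T x = (\<lambda>i. \<Sum>j\<in>J. x j * T (basis_vec j) i)"
      using sum[OF fin order_refl, of x] by simp
    moreover have "T x i = 0" if "i \<notin> J"
      using True T that by (auto simp: bounded_ops_def intro: ell2_outside)
    ultimately show ?thesis
      using True by (auto simp: mat_op_def op_entry_def mult.commute)
  next
    case False
    then show ?thesis using T by (auto simp: bounded_ops_def mat_op_def)
  qed
  then show ?thesis by auto
qed

lemma bounded_op_eqI:
  assumes "S \<in> bounded_ops J" "T \<in> bounded_ops J"
    and "\<And>i j. i \<in> J \<Longrightarrow> j \<in> J \<Longrightarrow> op_entry S i j = op_entry T i j"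
  shows "S = T"
proof -
  have "S = mat_op J (op_entry S)" by (rule bounded_op_eq_mat_op[OF assms(1)])
  also have "\<dots> = mat_op J (op_entry T)" by (rule mat_op_eqI[OF assms(3)])
  also have "\<dots> = T" by (rule bounded_op_eq_mat_op[OF assms(2), symmetric])
  finally show ?thesis .
qed

lemma op_one_mat_op: "op_one J = mat_op J (\<lambda>i j. if i = j then 1 else 0)"
proof (intro ext)
  fix x :: "'i \<Rightarrow> complex" and i
  have "(\<Sum>j\<in>J. (if i = j then 1 else 0) * x j) = (\<Sum>j\<in>J. (if j = i then 1 else 0) * x j)"
    by (intro sum.cong) auto
  then show "op_one J x i = mat_op J (\<lambda>i j. if i = j then 1 else 0) x i"
    using sum_if_eq(2)[OF fin, of i x] by (auto simp: op_one_def mat_op_def ell2_outside)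
qed

lemma op_zero_mat_op: "op_zero = mat_op J (\<lambda>i j. 0)"
  by (auto simp: op_zero_def mat_op_def fun_eq_iff)

lemma op_add_mat_op: "op_add (mat_op J f) (mat_op J g) = mat_op J (\<lambda>i j. f i j + g i j)"
  by (auto simp: op_add_def mat_op_def fun_eq_iff sum.distrib algebra_simps)

lemma op_scale_mat_op: "op_scale c (mat_op J f) = mat_op J (\<lambda>i j. c * f i j)"
  by (auto simp: op_scale_def mat_op_def fun_eq_iff sum_distrib_left algebra_simps)

lemma op_sum_mat_op:
  "finite K \<Longrightarrow> op_sum (\<lambda>k. mat_op J (f k)) K = mat_op J (\<lambda>i j. \<Sum>k\<in>K. f k i j)"
  by (auto simp: op_sum_def mat_op_def fun_eq_iff sum_distrib_right sum.swap[of _ J K])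

lemma comp_mat_op: "mat_op J f \<circ> mat_op J g = mat_op J (\<lambda>i j. \<Sum>k\<in>J. f i k * g k j)"
proof (intro ext)
  fix x i
  show "(mat_op J f \<circ> mat_op J g) x i = mat_op J (\<lambda>i j. \<Sum>k\<in>J. f i k * g k j) x i"
  proof (cases "x \<in> ell2 J \<and> i \<in> J")
    case True
    then have "(mat_op J f \<circ> mat_op J g) x i = (\<Sum>k\<in>J. f i k * (\<Sum>j\<in>J. g k j * x j))"
      by (simp add: mat_op_apply mat_op_ell2)
    also have "\<dots> = (\<Sum>j\<in>J. (\<Sum>k\<in>J. f i k * g k j) * x j)"
      by (simp add: sum_distrib_left sum_distrib_right mult.assoc) (rule sum.swap)
    finally show ?thesis using True by (simp add: mat_op_apply)
  next
    case False
    then show ?thesis by (auto simp: mat_op_def)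
  qed
qed

text \<open>The conjugate transpose satisfies the adjoint relation by swapping the two sums. Testing
  the relation on basis vectors fixes every entry of any other candidate, so the definite
  description is well defined.\<close>

lemma op_adjoint_mat_op: "op_adjoint J (mat_op J f) = mat_op J (\<lambda>i j. cnj (f j i))"
  unfolding op_adjoint_def
proof (rule the_equality)
  have "ell2_inner (mat_op J (\<lambda>i j. cnj (f j i)) x) y = ell2_inner x (mat_op J f y)"
    if "x \<in> ell2 J" "y \<in> ell2 J" for x y
  proof -
    have "ell2_inner (mat_op J (\<lambda>i j. cnj (f j i)) x) y = (\<Sum>i\<in>J. \<Sum>j\<in>J. cnj (x j) * f j i * y i)"
      by (simp add: ell2_inner_finite mat_op_ell2 mat_op_apply that sum_distrib_left sum_distrib_right mult_ac)
    also have "\<dots> = (\<Sum>j\<in>J. \<Sum>i\<in>J. cnj (x j) * f j i * y i)" by (rule sum.swap)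
    also have "\<dots> = ell2_inner x (mat_op J f y)"
      by (simp add: ell2_inner_finite mat_op_ell2 mat_op_apply that sum_distrib_left sum_distrib_right mult_ac)
    finally show ?thesis .
  qed
  then show "mat_op J (\<lambda>i j. cnj (f j i)) \<in> bounded_ops J \<and> (\<forall>x\<in>ell2 J. \<forall>y\<in>ell2 J.
      ell2_inner (mat_op J (\<lambda>i j. cnj (f j i)) x) y = ell2_inner x (mat_op J f y))"
    using mat_op_bounded by blast
next
  fix S assume S: "S \<in> bounded_ops J \<and> (\<forall>x\<in>ell2 J. \<forall>y\<in>ell2 J.
      ell2_inner (S x) y = ell2_inner x (mat_op J f y))"
  have "op_entry S i j = cnj (f j i)" if ij: "i \<in> J" "j \<in> J" for i j
  proof -
    have Sj: "S (basis_vec j) \<in> ell2 J" using S ij basis_vec_ell2 by (auto simp: bounded_ops_def)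
    have "ell2_inner (S (basis_vec j)) (basis_vec i) = cnj (op_entry S i j)"
      unfolding ell2_inner_finite[OF Sj] using sum_if_eq(1)[OF fin ij(1), of "\<lambda>k. cnj (S (basis_vec j) k)"]
      by (simp add: basis_vec_def op_entry_def)
    moreover have "ell2_inner (basis_vec j) (mat_op J f (basis_vec i)) = op_entry (mat_op J f) j i"
      unfolding ell2_inner_finite[OF basis_vec_ell2[OF ij(2)]] op_entry_def
      using sum_if_eq(2)[OF fin ij(2), of "mat_op J f (basis_vec i)"]
      by (simp add: basis_vec_def if_distrib cong: if_cong)
    ultimately have "cnj (op_entry S i j) = f j i"
      using S ij basis_vec_ell2 op_entry_mat_op by auto
    then show ?thesis by (metis complex_cnj_cnj)
  qed
  then show "S = mat_op J (\<lambda>i j. cnj (f j i))"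
    using S by (intro bounded_op_eqI) (auto simp: mat_op_bounded op_entry_mat_op)
qed

lemma mat_op_eq_iff: "mat_op J f = mat_op J g \<longleftrightarrow> (\<forall>i\<in>J. \<forall>j\<in>J. f i j = g i j)"
  by (metis mat_op_eqI op_entry_mat_op)

lemma ell2_inner_mat_op:
  "x \<in> ell2 J \<Longrightarrow> ell2_inner x (mat_op J f x) = (\<Sum>i\<in>J. \<Sum>j\<in>J. cnj (x i) * f i j * x j)"
  by (simp add: ell2_inner_finite mat_op_apply sum_distrib_left mult.assoc)

section \<open>The block algebra as a von Neumann algebra\<close>

lemma mat_op_block_algebra_iff:
  "mat_op J f \<in> block_algebra J l \<longleftrightarrow> (\<forall>i\<in>J. \<forall>j\<in>J. l i \<noteq> l j \<longrightarrow> f i j = 0)"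
  by (simp add: block_algebra_def mat_op_bounded op_entry_mat_op)

lemma block_algebraE:
  assumes "T \<in> block_algebra J l"
  obtains f where "T = mat_op J f" "\<And>i j. i \<in> J \<Longrightarrow> j \<in> J \<Longrightarrow> l i \<noteq> l j \<Longrightarrow> f i j = 0"
  using that[of "op_entry T"] assms bounded_op_eq_mat_op[of T] by (auto simp: block_algebra_def)

text \<open>An entry of \<open>T\<close> is the inner product of a basis vector with the image of
  another one, hence weakly continuous in \<open>T\<close>. The algebra is cut out by the vanishing
  of such entries, so it is an intersection of closed preimages.\<close>

lemma closedin_block_algebra: "closedin (weak_operator_topology J) (block_algebra J l)"
proof -
  let ?X = "weak_operator_topology J"
  have top: "topspace ?X = bounded_ops J"
    by (auto simp: weak_operator_topology_def topspace_pullback_topology)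
  have cl: "closedin ?X {T \<in> topspace ?X. op_entry T i j \<in> {0}}" if ij: "i \<in> J" "j \<in> J" for i j
  proof (rule closedin_continuous_map_preimage)
    let ?e = "(basis_vec i, basis_vec j)"
    have "continuous_map ?X euclidean
      ((\<lambda>F. F ?e) \<circ> (\<lambda>T. \<lambda>(x, y)\<in>ell2 J \<times> ell2 J. ell2_inner x (T y)))"
      unfolding weak_operator_topology_def
      using basis_vec_ell2 ij
      by (intro continuous_map_pullback continuous_map_product_projection) auto
    moreover have "((\<lambda>F. F ?e) \<circ> (\<lambda>T. \<lambda>(x, y)\<in>ell2 J \<times> ell2 J. ell2_inner x (T y)))
      = (\<lambda>T. op_entry T i j)"
    proof
      fix T :: "'i op"
      show "((\<lambda>F. F ?e) \<circ> (\<lambda>T. \<lambda>(x, y)\<in>ell2 J \<times> ell2 J. ell2_inner x (T y))) T = op_entry T i j"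
        using ij sum_if_eq(2)[OF fin ij(1), of "T (basis_vec j)"]
        by (simp add: basis_vec_ell2 ell2_inner_finite op_entry_def)
           (simp add: basis_vec_def if_distrib cong: if_cong)
    qed
    ultimately show "continuous_map ?X euclidean (\<lambda>T. op_entry T i j)" by simp
  qed simp
  \<comment> \<open>The whole space is inserted because the family of conditions is empty when
    \<open>l\<close> is constant on \<open>J\<close>; the intersection must then be all bounded
    operators.\<close>
  have "block_algebra J l = \<Inter> (insert (topspace ?X)
    ((\<lambda>(i, j). {T \<in> topspace ?X. op_entry T i j \<in> {0}}) ` {(i, j) \<in> J \<times> J. l i \<noteq> l j}))"
    by (auto simp: block_algebra_def top)
  also have "closedin ?X \<dots>" by (intro closedin_Inter) (use cl in auto)
  finally show ?thesis .
qed

lemma von_neumann_block_algebra: "von_neumann_algebra J (block_algebra J l)"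
  unfolding von_neumann_algebra_def
proof (intro conjI ballI allI closedin_block_algebra)
  show "block_algebra J l \<subseteq> bounded_ops J" by (auto simp: block_algebra_def)
  show "op_one J \<in> block_algebra J l" 
    by (auto simp: op_one_mat_op mat_op_block_algebra_iff)
next
  fix S T assume "S \<in> block_algebra J l" "T \<in> block_algebra J l"
  then obtain f g where f: "S = mat_op J f" "\<And>i j. i \<in> J \<Longrightarrow> j \<in> J \<Longrightarrow> l i \<noteq> l j \<Longrightarrow> f i j = 0"
    and g: "T = mat_op J g" "\<And>i j. i \<in> J \<Longrightarrow> j \<in> J \<Longrightarrow> l i \<noteq> l j \<Longrightarrow> g i j = 0"
    using block_algebraE by metis
  show "op_add S T \<in> block_algebra J l" 
    using f(2) g(2) by (auto simp: f(1) g(1) op_add_mat_op mat_op_block_algebra_iff)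
  \<comment> \<open>If the labels of i and j differ, every intermediate index k has a label
    different from that of i or that of j, so each term of the product has a vanishing
    factor.\<close>
  show "S \<circ> T \<in> block_algebra J l" 
    unfolding f(1) g(1) comp_mat_op mat_op_block_algebra_iff
    using f(2) g(2) by (metis (mono_tags, lifting) mult_eq_0_iff sum.neutral)
next
  fix c T assume "T \<in> block_algebra J l"
  then show "op_scale c T \<in> block_algebra J l"
    by (elim block_algebraE) (auto simp: op_scale_mat_op mat_op_block_algebra_iff)
next
  fix T assume "T \<in> block_algebra J l"
  then show "op_adjoint J T \<in> block_algebra J l"
    by (elim block_algebraE) (auto simp: op_adjoint_mat_op mat_op_block_algebra_iff)
qed

section \<open>The weighted trace as a faithful tracial state\<close>

lemma weighted_trace_mat_op: "weighted_trace J l (mat_op J f) = (\<Sum>i\<in>J. of_real (l i) * f i i)"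
  by (simp add: weighted_trace_def op_entry_mat_op)

text \<open>Both positivity and faithfulness are read off from this weighted sum of squares; the
  weight is attached to the column index.\<close>

lemma weighted_trace_adjoint_comp:
  "weighted_trace J l (op_adjoint J (mat_op J f) \<circ> mat_op J f) =
   of_real (\<Sum>i\<in>J. \<Sum>k\<in>J. l i * (cmod (f k i))\<^sup>2)"
proof -
  have "cnj z * z = of_real ((cmod z)\<^sup>2)" for z
    by (simp add: complex_norm_square mult.commute flip: of_real_power)
  then show ?thesis
    by (simp add: op_adjoint_mat_op comp_mat_op weighted_trace_mat_op sum_distrib_left)
qed

lemma state_on_weighted_trace:
  assumes "\<And>i. i \<in> J \<Longrightarrow> 0 \<le> l i" and "sum l J = 1"
  shows "state_on J (block_algebra J l) (weighted_trace J l)"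
  unfolding state_on_def
proof (intro conjI ballI allI)
  fix S T assume "S \<in> block_algebra J l" "T \<in> block_algebra J l"
  then obtain f g where "S = mat_op J f" "T = mat_op J g"
    using block_algebraE by metis
  then show "weighted_trace J l (op_add S T) = weighted_trace J l S + weighted_trace J l T"
    by (simp add: op_add_mat_op weighted_trace_mat_op algebra_simps sum.distrib)
next
  fix c T assume "T \<in> block_algebra J l"
  then show "weighted_trace J l (op_scale c T) = c * weighted_trace J l T"
    by (elim block_algebraE) (simp add: op_scale_mat_op weighted_trace_mat_op sum_distrib_left mult_ac)
next
  fix T assume "T \<in> block_algebra J l"
  then obtain f where "T = mat_op J f" using block_algebraE by metis
  moreover have "0 \<le> (\<Sum>i\<in>J. \<Sum>k\<in>J. l i * (cmod (f k i))\<^sup>2)"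
    using assms(1) by (intro sum_nonneg) auto
  ultimately show "0 \<le> weighted_trace J l (op_adjoint J T \<circ> T)"
    by (simp add: weighted_trace_adjoint_comp less_eq_complex_def)
next
  show "weighted_trace J l (op_one J) = 1"
    using assms(2) by (simp add: op_one_mat_op weighted_trace_mat_op flip: of_real_sum)
qed

text \<open>A sum of nonnegative terms vanishes only termwise, and a strictly positive weight can be
  cancelled from each term. This is the reason for restricting to the support of the
  catalyst.\<close>

lemma faithful_on_weighted_trace:
  assumes "\<And>i. i \<in> J \<Longrightarrow> 0 < l i"
  shows "faithful_on J (block_algebra J l) (weighted_trace J l)"
  unfolding faithful_on_def
proof (intro ballI impI)
  fix T assume "T \<in> block_algebra J l" and 0: "weighted_trace J l (op_adjoint J T \<circ> T) = 0"
  then obtain f where f: "T = mat_op J f" using block_algebraE by metis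
  have nonneg: "0 \<le> l i * (cmod (f k i))\<^sup>2" if "i \<in> J" for i k
    using assms[OF that] by simp
  have sum0: "(\<Sum>i\<in>J. \<Sum>k\<in>J. l i * (cmod (f k i))\<^sup>2) = 0"
    using 0 unfolding f weighted_trace_adjoint_comp by (simp only: of_real_eq_0_iff)
  have "f k i = 0" if i: "i \<in> J" and k: "k \<in> J" for i k
  proof -
    have "(\<Sum>k\<in>J. l i * (cmod (f k i))\<^sup>2) = 0"
      by (rule sum_nonneg_0[OF fin _ sum0 i]) (intro sum_nonneg nonneg)
    then have "l i * (cmod (f k i))\<^sup>2 = 0"
      by (rule sum_nonneg_0[OF fin nonneg[OF i] _ k])
    then show ?thesis using assms[OF i] by simp
  qed
  then show "T = op_zero" unfolding f op_zero_mat_op mat_op_eq_iff by auto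
qed

text \<open>A nonzero product of entries at i, k and k, i only links indices of equal weight, so the
  weight of i may be replaced by that of k before the sums are swapped. On the full matrix algebra
  this would fail for non-constant weights.\<close>

lemma tracial_on_weighted_trace: "tracial_on (block_algebra J l) (weighted_trace J l)"
  unfolding tracial_on_def
proof (intro ballI)
  fix S T assume "S \<in> block_algebra J l" "T \<in> block_algebra J l"
  then obtain f g where f: "S = mat_op J f" "\<And>i j. i \<in> J \<Longrightarrow> j \<in> J \<Longrightarrow> l i \<noteq> l j \<Longrightarrow> f i j = 0"
    and g: "T = mat_op J g" "\<And>i j. i \<in> J \<Longrightarrow> j \<in> J \<Longrightarrow> l i \<noteq> l j \<Longrightarrow> g i j = 0"
    using block_algebraE by metis
  have "weighted_trace J l (S \<circ> T) = (\<Sum>i\<in>J. \<Sum>k\<in>J. of_real (l i) * (f i k * g k i))"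
    by (simp add: f(1) g(1) comp_mat_op weighted_trace_mat_op sum_distrib_left)
  also have "\<dots> = (\<Sum>i\<in>J. \<Sum>k\<in>J. of_real (l k) * (g k i * f i k))"
  proof (intro sum.cong refl)
    fix i k assume "i \<in> J" "k \<in> J"
    then show "of_real (l i) * (f i k * g k i) = of_real (l k) * (g k i * f i k)"
      using f(2)[of i k] by (cases "l i = l k") auto
  qed
  also have "\<dots> = (\<Sum>k\<in>J. \<Sum>i\<in>J. of_real (l k) * (g k i * f i k))" by (rule sum.swap)
  also have "\<dots> = weighted_trace J l (T \<circ> S)"
    by (simp add: f(1) g(1) comp_mat_op weighted_trace_mat_op sum_distrib_left)
  finally show "weighted_trace J l (S \<circ> T) = weighted_trace J l (T \<circ> S)" .
qed

section \<open>Quadratic forms, polarisation and normality\<close>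

lemma mat_op_self_adjoint_iff:
  "mat_op J f \<in> self_adjoint_part J (block_algebra J l) \<longleftrightarrow>
    mat_op J f \<in> block_algebra J l \<and> (\<forall>i\<in>J. \<forall>j\<in>J. cnj (f j i) = f i j)"
  by (simp add: self_adjoint_part_def op_adjoint_mat_op mat_op_eq_iff)

lemma ell2_inner_self_adjoint_real:
  assumes "\<forall>i\<in>J. \<forall>j\<in>J. cnj (f j i) = f i j" and "x \<in> ell2 J"
  shows "Im (ell2_inner x (mat_op J f x)) = 0"
proof -
  have "cnj (ell2_inner x (mat_op J f x)) = (\<Sum>i\<in>J. \<Sum>j\<in>J. x i * cnj (f i j) * cnj (x j))"
    by (simp add: ell2_inner_mat_op assms(2))
  also have "\<dots> = (\<Sum>i\<in>J. \<Sum>j\<in>J. cnj (x j) * f j i * x i)"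
    by (intro sum.cong refl) (metis assms(1) mult.commute mult.assoc)
  also have "\<dots> = (\<Sum>j\<in>J. \<Sum>i\<in>J. cnj (x j) * f j i * x i)" by (rule sum.swap)
  also have "\<dots> = ell2_inner x (mat_op J f x)" by (simp add: ell2_inner_mat_op assms(2))
  finally show ?thesis by (simp add: complex_eq_iff)
qed

text \<open>The case i = j is included, so polarisation covers diagonal entries without a case
  split. The same expansion later shows that positive semidefinite matrices are Hermitian.\<close>

lemma ell2_inner_mat_op_two:
  assumes ij: "i \<in> J" "j \<in> J"
  defines "x a b \<equiv> (\<lambda>k. a * basis_vec i k + b * basis_vec j k)"
  shows "ell2_inner (x a b) (mat_op J f (x a b)) =
    cnj a * a * f i i + cnj a * b * f i j + cnj b * a * f j i + cnj b * b * f j j"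
proof -
  have x: "x a b \<in> ell2 J" using ij by (auto simp: ell2_finite_iff basis_vec_def x_def)
  have *: "(\<Sum>l\<in>J. g l * x a b l) = a * g i + b * g j" for g
  proof -
    have "(\<Sum>l\<in>J. g l * x a b l) = a * (\<Sum>l\<in>J. g l * (if l = i then 1 else 0))
      + b * (\<Sum>l\<in>J. g l * (if l = j then 1 else 0))"
      by (simp add: x_def basis_vec_def algebra_simps sum.distrib sum_distrib_left)
    then show ?thesis by (simp only: sum_if_eq(1)[OF fin ij(1)] sum_if_eq(1)[OF fin ij(2)])
  qed
  have **: "(\<Sum>l\<in>J. cnj (x a b l) * g l) = cnj a * g i + cnj b * g j" for g
    using arg_cong[OF *[of "\<lambda>l. cnj (g l)"], of cnj] by (simp add: mult.commute)
  show ?thesis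
    unfolding ell2_inner_mat_op[OF x] mult.assoc sum_distrib_left[symmetric] * **
    by (simp add: algebra_simps)
qed

text \<open>Subtracting i times the second evaluation from the first doubles \<open>f i j\<close>
  and cancels \<open>f j i\<close>. What remains is 1 - i times the two diagonal entries, which the
  last term removes.\<close>

lemma ell2_inner_polarisation:
  assumes T: "T = mat_op J f" and ij: "i \<in> J" "j \<in> J"
  defines "q x \<equiv> ell2_inner x (T x)"
  shows "f i j = (q (\<lambda>k. basis_vec i k + basis_vec j k) - \<i> * q (\<lambda>k. basis_vec i k + \<i> * basis_vec j k)
    - (1 - \<i>) * (q (basis_vec i) + q (basis_vec j))) / 2"
proof -
  have q: "q (\<lambda>k. a * basis_vec i k + b * basis_vec j k) =
    cnj a * a * f i i + cnj a * b * f i j + cnj b * a * f j i + cnj b * b * f j j" for a b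
    unfolding q_def T by (rule ell2_inner_mat_op_two[OF ij])
  have "q (\<lambda>k. basis_vec i k + basis_vec j k) = f i i + f i j + f j i + f j j"
    "q (\<lambda>k. basis_vec i k + \<i> * basis_vec j k) = f i i + \<i> * f i j - \<i> * f j i + f j j"
    "q (basis_vec i) = f i i" "q (basis_vec j) = f j j"
    using q[of 1 1] q[of 1 \<i>] q[of 1 0] q[of 0 1] by simp_all
  then have *: "q (\<lambda>k. basis_vec i k + basis_vec j k) - \<i> * q (\<lambda>k. basis_vec i k + \<i> * basis_vec j k)
      - (1 - \<i>) * (q (basis_vec i) + q (basis_vec j)) = 2 * f i j"
    by (simp only:) (simp add: algebra_simps)
  show ?thesis unfolding * by simp
qed

lemma tendsto_ell2_inner_mat_op:
  assumes "\<And>i j. i \<in> J \<Longrightarrow> j \<in> J \<Longrightarrow> ((\<lambda>T. op_entry T i j) \<longlongrightarrow> c i j) F"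
    and "eventually (\<lambda>T. T \<in> bounded_ops J) F" and x: "x \<in> ell2 J"
  shows "((\<lambda>T. ell2_inner x (T x)) \<longlongrightarrow> ell2_inner x (mat_op J c x)) F"
proof -
  have "((\<lambda>T. \<Sum>i\<in>J. \<Sum>j\<in>J. cnj (x i) * op_entry T i j * x j)
      \<longlongrightarrow> ell2_inner x (mat_op J c x)) F"
    unfolding ell2_inner_mat_op[OF x] by (intro tendsto_intros assms(1))
  then show ?thesis
  proof (rule Lim_transform_eventually)
    show "\<forall>\<^sub>F T in F. (\<Sum>i\<in>J. \<Sum>j\<in>J. cnj (x i) * op_entry T i j * x j) = ell2_inner x (T x)"
      using assms(2) by eventually_elim (metis ell2_inner_mat_op[OF x] bounded_op_eq_mat_op)
  qed
qed

text \<open>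
  The quadratic forms of an increasing bounded net converge, hence by polarisation so do the
  matrix entries. The entrywise limit is an upper bound of the net, so it dominates the supremum.
\<close>

lemma normal_on_weighted_trace:
  assumes pos: "\<And>i. i \<in> J \<Longrightarrow> 0 \<le> l i"
  shows "normal_on J (block_algebra J l) (weighted_trace J l)"
  unfolding normal_on_def
proof (intro allI impI, elim conjE)
  fix D a
  assume D: "D \<subseteq> self_adjoint_part J (block_algebra J l)" and dir: "op_directed J D"
    and lub: "op_lub J (block_algebra J l) D a"
  let ?N = "block_algebra J l"
  let ?\<tau> = "weighted_trace J l"
  have bnd: "T \<in> bounded_ops J" if "T \<in> D" for T
    using that D by (auto simp: self_adjoint_part_def block_algebra_def)
  have aN: "a \<in> ?N" using lub by (auto simp: op_lub_def self_adjoint_part_def)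
  have D_le: "op_le J b a" if "b \<in> D" for b using that lub by (auto simp: op_lub_def)
  have D_ne: "D \<noteq> {}" using dir by (simp add: op_directed_def)
  \<comment> \<open>Diagonal entries are the quadratic form at basis vectors, so the operator order
    controls them one by one; nonnegative weights preserve the inequalities.\<close>
  have trace_mono: "Re (?\<tau> S) \<le> Re (?\<tau> T)" if "op_le J S T" for S T
  proof -
    have "Re (op_entry S i i) \<le> Re (op_entry T i i)" if i: "i \<in> J" for i
    proof -
      have "ell2_inner (basis_vec i) (R (basis_vec i)) = op_entry R i i" for R
        unfolding ell2_inner_finite[OF basis_vec_ell2[OF i]] op_entry_def
        using sum_if_eq(2)[OF fin i, of "R (basis_vec i)"]
        by (simp add: basis_vec_def if_distrib cong: if_cong)
      then show ?thesis
        using \<open>op_le J S T\<close> basis_vec_ell2[OF i] by (metis op_le_def less_eq_complex_def)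
    qed
    then show ?thesis
      unfolding weighted_trace_def Re_sum using pos by (intro sum_mono) (simp add: mult_left_mono)
  qed
  \<comment> \<open>The filter of tails of \<open>D\<close>: a property holds eventually if it holds
    for all members above some \<open>b\<close>. Directedness makes the tails a filter base, so
    limits along the net become filter limits.\<close>
  define F where "F = (INF b\<in>D. principal {c \<in> D. op_le J b c})"
  have ev_F: "eventually P F \<longleftrightarrow> (\<exists>b\<in>D. \<forall>c\<in>D. op_le J b c \<longrightarrow> P c)" for P
    unfolding F_def
  proof (subst eventually_INF_base[OF D_ne])
    fix b c assume "b \<in> D" "c \<in> D"
    then obtain e where "e \<in> D" "op_le J b e" "op_le J c e"
      using dir by (auto simp: op_directed_def)
    then show "\<exists>x\<in>D. principal {c \<in> D. op_le J x c}
        \<le> inf (principal {c \<in> D. op_le J b c}) (principal {d \<in> D. op_le J c d})"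
      by (intro bexI[of _ e]) (auto simp: op_le_def intro: order_trans)
  qed (auto simp: eventually_principal)
  have le_refl: "op_le J b b" for b by (simp add: op_le_def)
  have F_nt: "F \<noteq> bot"
    using D_ne le_refl ev_F[of "\<lambda>_. False"] by (auto simp: trivial_limit_def)
  have ev_D: "eventually (\<lambda>b. b \<in> D) F" using D_ne ev_F by blast
  have real: "Im (ell2_inner x (b x)) = 0" if "b \<in> D" "x \<in> ell2 J" for b x
  proof -
    have b: "b = mat_op J (op_entry b)" using bounded_op_eq_mat_op bnd that by blast
    then have "mat_op J (op_entry b) \<in> self_adjoint_part J ?N" using D that by auto
    then show ?thesis
      using ell2_inner_self_adjoint_real[OF _ that(2)] b by (metis mat_op_self_adjoint_iff)
  qed
  \<comment> \<open>Monotone convergence: the real parts increase along the net and are bounded by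
    the value at \<open>a\<close>, so they tend to their supremum. The imaginary parts vanish by
    self-adjointness.\<close>
  have "\<exists>q. ((\<lambda>b. ell2_inner x (b x)) \<longlongrightarrow> q) F" if x: "x \<in> ell2 J" for x
  proof -
    let ?r = "\<lambda>b. Re (ell2_inner x (b x))"
    have bdd: "bdd_above (?r ` D)"
      using D_le x by (intro bdd_aboveI2[of _ _ "?r a"]) (auto simp: op_le_def less_eq_complex_def)
    have "(?r \<longlongrightarrow> (SUP b\<in>D. ?r b)) F"
    proof (rule order_tendstoI)
      fix y assume "y < (SUP b\<in>D. ?r b)"
      then obtain b where b: "b \<in> D" "y < ?r b"
        using less_cSUP_iff[OF D_ne bdd] by blast
      have "y < ?r c" if "op_le J b c" for c
        using that b x by (fastforce simp: op_le_def less_eq_complex_def)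
      then show "eventually (\<lambda>b. y < ?r b) F" using b(1) ev_F by blast
    next
      fix y assume "y > (SUP b\<in>D. ?r b)"
      then show "eventually (\<lambda>b. ?r b < y) F"
        using ev_D by (auto elim!: eventually_mono intro: le_less_trans cSUP_upper[OF _ bdd])
    qed
    then have "((\<lambda>b. complex_of_real (?r b)) \<longlongrightarrow> of_real (SUP b\<in>D. ?r b)) F"
      by (rule tendsto_of_real)
    moreover have "\<forall>\<^sub>F b in F. complex_of_real (?r b) = ell2_inner x (b x)"
      using ev_D by eventually_elim (use real x in \<open>auto simp: complex_eq_iff\<close>)
    ultimately show ?thesis by (intro exI) (rule Lim_transform_eventually)
  qed
  then obtain q where q: "((\<lambda>b. ell2_inner x (b x)) \<longlongrightarrow> q x) F" if "x \<in> ell2 J" for x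
    by metis
  have "\<exists>c. ((\<lambda>b. op_entry b i j) \<longlongrightarrow> c) F" if ij: "i \<in> J" "j \<in> J" for i j
  proof
    let ?x = "\<lambda>k. basis_vec i k + basis_vec j k"
    let ?y = "\<lambda>k. basis_vec i k + \<i> * basis_vec j k"
    have x: "?x \<in> ell2 J" "?y \<in> ell2 J" "basis_vec i \<in> ell2 J" "basis_vec j \<in> ell2 J"
      using ij by (auto simp: ell2_finite_iff basis_vec_def)
    have "((\<lambda>b. (ell2_inner ?x (b ?x) - \<i> * ell2_inner ?y (b ?y)
      - (1 - \<i>) * (ell2_inner (basis_vec i) (b (basis_vec i))
        + ell2_inner (basis_vec j) (b (basis_vec j)))) / 2) \<longlongrightarrow>
      (q ?x - \<i> * q ?y - (1 - \<i>) * (q (basis_vec i) + q (basis_vec j))) / 2) F"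
      by (intro tendsto_intros q x) simp
    then show "((\<lambda>b. op_entry b i j) \<longlongrightarrow>
      (q ?x - \<i> * q ?y - (1 - \<i>) * (q (basis_vec i) + q (basis_vec j))) / 2) F"
    proof (rule Lim_transform_eventually)
      show "\<forall>\<^sub>F b in F. (ell2_inner ?x (b ?x) - \<i> * ell2_inner ?y (b ?y)
        - (1 - \<i>) * (ell2_inner (basis_vec i) (b (basis_vec i))
          + ell2_inner (basis_vec j) (b (basis_vec j)))) / 2 = op_entry b i j"
        using ev_D
        by eventually_elim (rule ell2_inner_polarisation[symmetric, OF bounded_op_eq_mat_op[OF bnd] ij])
    qed
  qed
  then obtain c where c: "((\<lambda>b. op_entry b i j) \<longlongrightarrow> c i j) F" if "i \<in> J" "j \<in> J" for i j
    by metis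
  \<comment> \<open>The limit has to lie in the self-adjoint part of the algebra, since
    \<open>op_lub\<close> compares \<open>a\<close> only with upper bounds from there. Both
    conditions survive entrywise limits.\<close>
  have "mat_op J c \<in> self_adjoint_part J ?N"
    unfolding mat_op_self_adjoint_iff mat_op_block_algebra_iff
  proof (intro conjI ballI impI)
    fix i j assume ij: "i \<in> J" "j \<in> J"
    have "\<forall>\<^sub>F b in F. cnj (op_entry b j i) = op_entry b i j"
      using ev_D
    proof eventually_elim
      case (elim b)
      then have "mat_op J (op_entry b) \<in> self_adjoint_part J ?N"
        using D bounded_op_eq_mat_op bnd by fastforce
      then show ?case using ij unfolding mat_op_self_adjoint_iff by metis
    qed
    moreover have "((\<lambda>b. cnj (op_entry b j i)) \<longlongrightarrow> cnj (c j i)) F"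
      by (intro tendsto_cnj c ij)
    ultimately have "((\<lambda>b. op_entry b i j) \<longlongrightarrow> cnj (c j i)) F"
      by - (rule Lim_transform_eventually)
    then show "cnj (c j i) = c i j" using tendsto_unique[OF F_nt] c[OF ij] by blast
    assume "l i \<noteq> l j"
    then have "\<forall>\<^sub>F b in F. op_entry b i j = 0"
      using ev_D ij D by (auto simp: self_adjoint_part_def block_algebra_def elim!: eventually_mono)
    then have "((\<lambda>b. op_entry b i j) \<longlongrightarrow> 0) F" by (rule tendsto_eventually)
    then show "c i j = 0" using tendsto_unique[OF F_nt] c[OF ij] by blast
  qed
  moreover have "op_le J b (mat_op J c)" if b: "b \<in> D" for b
    unfolding op_le_def
  proof
    fix x assume x: "x \<in> ell2 J"
    have lim: "((\<lambda>b. ell2_inner x (b x)) \<longlongrightarrow> ell2_inner x (mat_op J c x)) F"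
      using ev_D bnd by (intro tendsto_ell2_inner_mat_op c x) (auto elim: eventually_mono)
    have ev: "\<forall>\<^sub>F e in F. ell2_inner x (b x) \<le> ell2_inner x (e x)"
      using b x ev_F by (auto simp: op_le_def)
    have "Re (ell2_inner x (b x)) \<le> Re (ell2_inner x (mat_op J c x))"
      using ev by (intro tendsto_lowerbound[OF tendsto_Re[OF lim] _ F_nt])
        (auto simp: less_eq_complex_def elim: eventually_mono)
    \<comment> \<open>Comparable complex numbers have equal imaginary parts, so along the tail above
      \<open>b\<close> the imaginary part is constant and the limit inherits it.\<close>
    moreover have "((\<lambda>e. Im (ell2_inner x (e x))) \<longlongrightarrow> Im (ell2_inner x (b x))) F"
      using ev by (intro tendsto_eventually) (auto simp: less_eq_complex_def elim: eventually_mono)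
    then have "Im (ell2_inner x (b x)) = Im (ell2_inner x (mat_op J c x))"
      using tendsto_unique[OF F_nt] tendsto_Im[OF lim] by blast
    ultimately show "ell2_inner x (b x) \<le> ell2_inner x (mat_op J c x)"
      by (simp add: less_eq_complex_def)
  qed
  ultimately have "op_le J a (mat_op J c)" using lub by (auto simp: op_lub_def)
  then have "Re (?\<tau> a) \<le> Re (?\<tau> (mat_op J c))" by (rule trace_mono)
  also have "\<dots> \<le> (SUP b\<in>D. Re (?\<tau> b))"
  proof (rule tendsto_upperbound[OF tendsto_Re _ F_nt])
    show "(?\<tau> \<longlongrightarrow> ?\<tau> (mat_op J c)) F"
      unfolding weighted_trace_mat_op unfolding weighted_trace_def by (intro tendsto_intros c)
    have "bdd_above ((\<lambda>b. Re (?\<tau> b)) ` D)"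
      using D_le trace_mono by (intro bdd_aboveI2) blast
    then show "\<forall>\<^sub>F b in F. Re (?\<tau> b) \<le> (SUP b\<in>D. Re (?\<tau> b))"
      using ev_D by (auto elim!: eventually_mono intro: cSUP_upper)
  qed
  finally have "Re (?\<tau> a) \<le> (SUP b\<in>D. Re (?\<tau> b))" .
  moreover have "(SUP b\<in>D. Re (?\<tau> b)) \<le> Re (?\<tau> a)"
    using D_ne D_le trace_mono by (intro cSUP_least) auto
  ultimately show "(SUP b\<in>D. Re (?\<tau> b)) = Re (?\<tau> a)" by simp
qed

end

section \<open>Tensor products, partial traces and states\<close>

lemma sum_lessThan_mult:
  fixes f :: "nat \<Rightarrow> 'a :: comm_monoid_add"
  shows "(\<Sum>k<m * n. f k) = (\<Sum>a<m. \<Sum>r<n. f (a * n + r))"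
proof -
  have "(\<Sum>k<m * n. f k) = (\<Sum>a<m. sum f {a * n..<a * n + n})"
    by (rule sum.nat_group[symmetric])
  also have "\<dots> = (\<Sum>a<m. \<Sum>r<n. f (a * n + r))"
  proof (rule sum.cong[OF refl])
    fix a show "sum f {a * n..<a * n + n} = (\<Sum>r<n. f (a * n + r))"
      using sum.shift_bounds_nat_ivl[of f 0 "a * n" n] by (simp add: add.commute lessThan_atLeast0)
  qed
  finally show ?thesis .
qed

lemma block_index_less: "a < m \<Longrightarrow> r < n \<Longrightarrow> a * n + r < m * (n :: nat)"
proof -
  assume "a < m" "r < n"
  then have "a * n + r < Suc a * n" "Suc a * n \<le> m * n" by (simp, intro mult_le_mono1) auto
  then show ?thesis by linarith
qed

lemma block_index_eq_iff:
  "r < n \<Longrightarrow> s < n \<Longrightarrow> a * n + r = b * n + s \<longleftrightarrow> a = b \<and> r = (s :: nat)"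
  by (metis add.commute div_mult_self3 less_nat_zero_code mod_mult_self3 mod_less div_less add_0 bot_nat_0.not_eq_extremum)

lemma eq_mat_blockI:
  assumes "A \<in> carrier_mat (m * n) (m' * n')" "B \<in> carrier_mat (m * n) (m' * n')"
    and "\<And>a r b t. a < m \<Longrightarrow> r < n \<Longrightarrow> b < m' \<Longrightarrow> t < n' \<Longrightarrow>
      A $$ (a * n + r, b * n' + t) = B $$ (a * n + r, b * n' + t)"
  shows "A = B"
proof (rule eq_matI)
  fix i j assume "i < dim_row B" "j < dim_col B"
  then have ij: "i < m * n" "j < m' * n'" using assms(2) by auto
  then have "n > 0" "n' > 0" by (auto intro: gr0I)
  then show "A $$ (i, j) = B $$ (i, j)"
    using assms(3)[of "i div n" "i mod n" "j div n'" "j mod n'"] ij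
    by (simp add: less_mult_imp_div_less)
qed (use assms in auto)

lemma kron_carrier [intro]:
  "A \<in> carrier_mat m m' \<Longrightarrow> B \<in> carrier_mat n n' \<Longrightarrow> kron A B \<in> carrier_mat (m * n) (m' * n')"
  by (auto simp: kron_def)

lemma index_kron:
  assumes "A \<in> carrier_mat m m'" "B \<in> carrier_mat n n'" "a < m" "r < n" "b < m'" "t < n'"
  shows "kron A B $$ (a * n + r, b * n' + t) = A $$ (a, b) * B $$ (r, t)"
  using assms block_index_less[of a m r n] block_index_less[of b m' t n'] by (simp add: kron_def)

lemma index_mult_mat_block:
  assumes "A \<in> carrier_mat k (m * n)" "B \<in> carrier_mat (m * n) k'" "i < k" "j < k'"
  shows "(A * B) $$ (i, j) = (\<Sum>a<m. \<Sum>r<n. A $$ (i, a * n + r) * B $$ (a * n + r, j))"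
  by (simp only: index_mat_mult_sum[OF assms] sum_lessThan_mult)

lemma kron_mult:
  fixes A B C D :: "complex mat"
  assumes "A \<in> carrier_mat m m" "C \<in> carrier_mat m m" "B \<in> carrier_mat n n" "D \<in> carrier_mat n n"
  shows "kron A B * kron C D = kron (A * C) (B * D)"
proof (rule eq_mat_blockI)
  fix a r b t assume *: "a < m" "r < n" "b < m" "t < n"
  have "(kron A B * kron C D) $$ (a * n + r, b * n + t) =
    (\<Sum>c<m. \<Sum>s<n. (A $$ (a, c) * B $$ (r, s)) * (C $$ (c, b) * D $$ (s, t)))"
    using assms * block_index_less
    by (subst index_mult_mat_block[of _ "m * n" m n _ "m * n"])
      (auto simp: index_kron[OF assms(1,3)] index_kron[OF assms(2,4)])
  also have "\<dots> = (A * C) $$ (a, b) * (B * D) $$ (r, t)"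
    unfolding index_mat_mult_sum[OF assms(1,2) *(1,3)] index_mat_mult_sum[OF assms(3,4) *(2,4)]
    by (simp add: sum_product mult_ac)
  also have "\<dots> = kron (A * C) (B * D) $$ (a * n + r, b * n + t)"
    using assms * by (subst index_kron[of _ m m _ n n]) (auto intro: mult_square_carrier)
  finally show "(kron A B * kron C D) $$ (a * n + r, b * n + t) = kron (A * C) (B * D) $$ (a * n + r, b * n + t)" .
qed (use assms in \<open>auto intro!: mult_carrier_mat kron_carrier\<close>)

lemma mat_adjoint_kron:
  assumes "A \<in> carrier_mat m m" "B \<in> carrier_mat n n"
  shows "mat_adjoint (kron A B) = kron (mat_adjoint A) (mat_adjoint B)"
proof (rule eq_mat_blockI)
  fix a r b t assume *: "a < m" "r < n" "b < m" "t < n"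
  have "mat_adjoint (kron A B) $$ (a * n + r, b * n + t) = cnj (kron A B $$ (b * n + t, a * n + r))"
    using kron_carrier[OF assms] * block_index_less by (subst index_mat_adjoint) auto
  also have "\<dots> = kron (mat_adjoint A) (mat_adjoint B) $$ (a * n + r, b * n + t)"
    using assms * by (simp add: index_kron[of _ m m _ n n])
  finally show "mat_adjoint (kron A B) $$ (a * n + r, b * n + t) =
    kron (mat_adjoint A) (mat_adjoint B) $$ (a * n + r, b * n + t)" .
qed (use assms in auto)

lemma kron_one: "kron (1\<^sub>m m) (1\<^sub>m n) = (1\<^sub>m (m * n) :: complex mat)"
proof (rule eq_mat_blockI)
  fix a r b t assume *: "a < m" "r < n" "b < m" "t < n"
  then show "kron (1\<^sub>m m) (1\<^sub>m n) $$ (a * n + r, b * n + t) = (1\<^sub>m (m * n) :: complex mat) $$ (a * n + r, b * n + t)"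
    using block_index_less block_index_eq_iff[of r n t a b]
    by (auto simp: index_kron[of _ m m _ n n])
qed auto

lemma unitary_kron_one:
  assumes "unitary_mat n R"
  shows "unitary_mat (m * n) (kron (1\<^sub>m m) R)"
proof -
  have R: "R \<in> carrier_mat n n" using assms by (simp add: unitary_mat_def)
  then have "mat_adjoint (kron (1\<^sub>m m) R) = kron (1\<^sub>m m) (mat_adjoint R)"
    by (simp add: mat_adjoint_kron[of _ m _ n])
  then show ?thesis
    using assms R kron_carrier[of "1\<^sub>m m" m m R n n]
    by (simp add: unitary_mat_def kron_mult[of _ m _ _ n] kron_one)
qed

text \<open>The outer factors act inside blocks only: the block at a, b is multiplied by
  \<open>S\<close> on the left and \<open>T\<close> on the right, and no other block enters. Both
  partial trace rules below follow from this formula.\<close>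

lemma index_kron_one_conj:
  assumes X: "X \<in> carrier_mat (m * n) (m * n)" and S: "S \<in> carrier_mat n n" and T: "T \<in> carrier_mat n n"
    and *: "a < m" "r < n" "b < m" "t < n"
  shows "(kron (1\<^sub>m m) S * X * kron (1\<^sub>m m) T) $$ (a * n + r, b * n + t) =
    (\<Sum>q<n. (\<Sum>p<n. S $$ (r, p) * X $$ (a * n + p, b * n + q)) * T $$ (q, t))"
proof -
  note idx = block_index_less[of _ m _ n]
  have KS: "kron (1\<^sub>m m) S \<in> carrier_mat (m * n) (m * n)" and KT: "kron (1\<^sub>m m) T \<in> carrier_mat (m * n) (m * n)"
    using S T by auto
  have left: "(kron (1\<^sub>m m) S * X) $$ (a * n + r, c * n + q) = (\<Sum>p<n. S $$ (r, p) * X $$ (a * n + p, c * n + q))"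
    if "c < m" "q < n" for c q
  proof -
    have "(kron (1\<^sub>m m) S * X) $$ (a * n + r, c * n + q) =
      (\<Sum>e<m. \<Sum>p<n. (1\<^sub>m m $$ (a, e) * S $$ (r, p)) * X $$ (e * n + p, c * n + q))"
      using * that S idx by (subst index_mult_mat_block[OF KS X])
        (auto simp: index_kron[OF one_carrier_mat S])
    also have "\<dots> = (\<Sum>e<m. if e = a then \<Sum>p<n. S $$ (r, p) * X $$ (e * n + p, c * n + q) else 0)"
      using * by (intro sum.cong) auto
    finally show ?thesis using * by simp
  qed
  have "(kron (1\<^sub>m m) S * X * kron (1\<^sub>m m) T) $$ (a * n + r, b * n + t) =
    (\<Sum>c<m. \<Sum>q<n. (\<Sum>p<n. S $$ (r, p) * X $$ (a * n + p, c * n + q)) * (1\<^sub>m m $$ (c, b) * T $$ (q, t)))"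
    using * T idx by (subst index_mult_mat_block[OF mult_square_carrier[OF KS X] KT])
      (auto simp: left index_kron[OF one_carrier_mat T] simp del: index_mult_mat)
  also have "\<dots> = (\<Sum>c<m. if c = b then \<Sum>q<n. (\<Sum>p<n. S $$ (r, p) * X $$ (a * n + p, c * n + q)) * T $$ (q, t) else 0)"
    using * by (intro sum.cong) auto
  finally show ?thesis using * by simp
qed

text \<open>Tracing out A adds up the diagonal blocks, and multiplying blocks by \<open>S\<close>
  and \<open>T\<close> is linear. This lets a change of basis on the catalyst pass through its
  marginal.\<close>

lemma ptrace_A_kron_conj:
  assumes X: "X \<in> carrier_mat (m * n) (m * n)" and S: "S \<in> carrier_mat n n" and T: "T \<in> carrier_mat n n"
  shows "ptrace_A m n (kron (1\<^sub>m m) S * X * kron (1\<^sub>m m) T) = S * ptrace_A m n X * T"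
proof (rule eq_matI)
  fix r t assume "r < dim_row (S * ptrace_A m n X * T)" "t < dim_col (S * ptrace_A m n X * T)"
  then have rt: "r < n" "t < n" using S T by auto
  have P: "ptrace_A m n X \<in> carrier_mat n n" by (simp add: ptrace_A_def)
  have "ptrace_A m n (kron (1\<^sub>m m) S * X * kron (1\<^sub>m m) T) $$ (r, t) =
    (\<Sum>a<m. \<Sum>q<n. \<Sum>p<n. S $$ (r, p) * X $$ (a * n + p, a * n + q) * T $$ (q, t))"
    using rt by (simp add: ptrace_A_def index_kron_one_conj[OF X S T] sum_distrib_right del: index_mult_mat)
  also have "\<dots> = (\<Sum>q<n. \<Sum>a<m. \<Sum>p<n. S $$ (r, p) * X $$ (a * n + p, a * n + q) * T $$ (q, t))"
    by (rule sum.swap)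
  also have "\<dots> = (\<Sum>q<n. \<Sum>p<n. \<Sum>a<m. S $$ (r, p) * X $$ (a * n + p, a * n + q) * T $$ (q, t))"
    by (rule sum.cong[OF refl], rule sum.swap)
  also have "\<dots> = (S * ptrace_A m n X * T) $$ (r, t)"
    unfolding index_mat_mult_sum[OF mult_square_carrier[OF S P] T rt]
    using rt by (intro sum.cong refl, subst index_mat_mult_sum[OF S P])
      (auto simp: ptrace_A_def sum_distrib_right sum_distrib_left)
  finally show "ptrace_A m n (kron (1\<^sub>m m) S * X * kron (1\<^sub>m m) T) $$ (r, t) = (S * ptrace_A m n X * T) $$ (r, t)" .
qed (use S T in \<open>auto simp: ptrace_A_def\<close>)

text \<open>Tracing out B takes the trace of each block, which is invariant under unitary
  conjugation. Hence rotating the catalyst after the interaction leaves the channel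
  unchanged.\<close>

lemma ptrace_B_kron_conj:
  assumes X: "X \<in> carrier_mat (m * n) (m * n)" and R: "unitary_mat n R"
  shows "ptrace_B m n (kron (1\<^sub>m m) (mat_adjoint R) * X * kron (1\<^sub>m m) R) = ptrace_B m n X"
proof (rule eq_matI)
  have Rc: "R \<in> carrier_mat n n" "mat_adjoint R \<in> carrier_mat n n" and RR: "R * mat_adjoint R = 1\<^sub>m n"
    using R by (auto simp: unitary_mat_def)
  fix a b assume "a < dim_row (ptrace_B m n X)" "b < dim_col (ptrace_B m n X)"
  then have ab: "a < m" "b < m" by (auto simp: ptrace_B_def)
  have RR': "(\<Sum>r<n. R $$ (q, r) * mat_adjoint R $$ (r, p)) = (if p = q then 1 else 0)"
    if "p < n" "q < n" for p q
    using index_mat_mult_sum[OF Rc that(2,1)] that by (auto simp: RR simp del: index_mult_mat)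
  have "ptrace_B m n (kron (1\<^sub>m m) (mat_adjoint R) * X * kron (1\<^sub>m m) R) $$ (a, b) =
    (\<Sum>r<n. \<Sum>q<n. \<Sum>p<n. X $$ (a * n + p, b * n + q) * (R $$ (q, r) * mat_adjoint R $$ (r, p)))"
    using ab by (simp add: ptrace_B_def index_kron_one_conj[OF X Rc(2,1)] sum_distrib_left sum_distrib_right mult_ac
      del: index_mult_mat index_mat_adjoint)
  also have "\<dots> = (\<Sum>q<n. \<Sum>r<n. \<Sum>p<n. X $$ (a * n + p, b * n + q) * (R $$ (q, r) * mat_adjoint R $$ (r, p)))"
    by (rule sum.swap)
  also have "\<dots> = (\<Sum>q<n. \<Sum>p<n. \<Sum>r<n. X $$ (a * n + p, b * n + q) * (R $$ (q, r) * mat_adjoint R $$ (r, p)))"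
    by (rule sum.cong[OF refl], rule sum.swap)
  also have "\<dots> = (\<Sum>q<n. \<Sum>p<n. X $$ (a * n + p, b * n + q) * (if p = q then 1 else 0))"
    by (intro sum.cong refl) (simp add: RR' flip: sum_distrib_left del: index_mat_adjoint)
  also have "\<dots> = ptrace_B m n X $$ (a, b)"
    using ab by (simp add: sum_if_eq(1) ptrace_B_def)
  finally show "ptrace_B m n (kron (1\<^sub>m m) (mat_adjoint R) * X * kron (1\<^sub>m m) R) $$ (a, b) = ptrace_B m n X $$ (a, b)" .
qed (auto simp: ptrace_B_def)

section \<open>States: spanning property and spectral data\<close>

lemma rank_one_quantum_state:
  assumes "0 \<le> c" and "of_real c * (\<Sum>i<d. v i * cnj (v i)) = 1"
  shows "quantum_state d (mat d d (\<lambda>(i, j). of_real c * (v i * cnj (v j))))"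
proof -
  let ?A = "mat d d (\<lambda>(i, j). of_real c * (v i * cnj (v j)))"
  have "0 \<le> (?A *\<^sub>v x) \<bullet>c x" if x: "x \<in> carrier_vec d" for x
  proof -
    \<comment> \<open>The quadratic form of a rank-one matrix at \<open>x\<close> is
      \<open>c\<close> times the squared modulus of one inner product, here called
      \<open>z\<close>.\<close>
    define z where "z = (\<Sum>i<d. v i * cnj (x $ i))"
    have "(?A *\<^sub>v x) \<bullet>c x = (\<Sum>i<d. (\<Sum>j<d. of_real c * (v i * cnj (v j)) * x $ j) * cnj (x $ i))"
      using x by (auto simp: scalar_prod_def lessThan_atLeast0 intro!: sum.cong)
    also have "\<dots> = (\<Sum>i<d. \<Sum>j<d. of_real c * ((v i * cnj (x $ i)) * (cnj (v j) * x $ j)))"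
      by (simp add: sum_distrib_left sum_distrib_right mult_ac)
    also have "\<dots> = of_real c * (z * (\<Sum>j<d. cnj (v j) * x $ j))"
      by (simp only: z_def sum_product) (simp only: sum_distrib_left)
    also have "(\<Sum>j<d. cnj (v j) * x $ j) = cnj z"
      by (simp add: z_def)
    also have "of_real c * (z * cnj z) = of_real (c * (cmod z)\<^sup>2)"
      by (simp only: of_real_mult complex_norm_square)
    finally show ?thesis using assms(1) by (simp add: less_eq_complex_def)
  qed
  then show ?thesis
    using assms(2) by (simp add: quantum_state_def psd_def trace_mat_def sum_distrib_left)
qed

definition unit_mat :: "nat \<Rightarrow> nat \<Rightarrow> nat \<Rightarrow> complex mat" where
  "unit_mat d k l = mat d d (\<lambda>(i, j). if i = k \<and> j = l then 1 else 0)"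

lemma unit_mat_carrier [simp]: "unit_mat d k l \<in> carrier_mat d d"
  by (simp add: unit_mat_def)

lemma unit_mat_quantum_state:
  assumes "k < d"
  shows "quantum_state d (unit_mat d k k)"
proof -
  have "(\<Sum>i<d. (if i = k then 1 else 0) * cnj (if i = k then 1 else 0)) = (\<Sum>i<d. if i = k then 1 else 0)"
    by (intro sum.cong) auto
  then have "quantum_state d (mat d d (\<lambda>(i, j). of_real 1 *
      ((if i = k then 1 else 0) * cnj (if j = k then 1 else 0))))"
    using assms by (intro rank_one_quantum_state) auto
  moreover have "mat d d (\<lambda>(i, j). of_real 1 * ((if i = k then 1 else 0) * cnj (if j = k then 1 else 0)))
    = unit_mat d k k"
    by (intro eq_matI) (auto simp: unit_mat_def)
  ultimately show ?thesis by simp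
qed

text \<open>States span all matrices: diagonal unit matrices are states, off-diagonal ones are
  combinations of states by polarisation. It is needed because \<open>catalytic\<close> describes
  the map on states, while \<open>factorizable\<close> asks for all matrices.\<close>

lemma linear_map_eq_on_states:
  assumes F: "linear_map_mat d F" and G: "linear_map_mat d G"
    and eq: "\<And>\<rho>. quantum_state d \<rho> \<Longrightarrow> F \<rho> = G \<rho>" and X: "X \<in> carrier_mat d d"
  shows "F X = G X"
proof -
  define E where "E Y \<longleftrightarrow> Y \<in> carrier_mat d d \<and> F Y = G Y" for Y
  have add: "E (Y + Z)" if "E Y" "E Z" for Y Z
    using that F G by (auto simp: E_def linear_map_mat_def)
  have scale: "E (c \<cdot>\<^sub>m Y)" if "E Y" for Y c
    using that F G by (auto simp: E_def linear_map_mat_def)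
  have state: "E \<rho>" if "quantum_state d \<rho>" for \<rho>
    using that eq by (auto simp: E_def quantum_state_def psd_def)
  have unit: "E (unit_mat d k l)" if kl: "k < d" "l < d" for k l
  proof (cases "k = l")
    case True
    then show ?thesis using state unit_mat_quantum_state kl by simp
  next
    case False
    let ?v = "\<lambda>c i. (if i = k then 1 else 0) + c * (if i = l then 1 else 0) :: complex"
    let ?S = "\<lambda>c. mat d d (\<lambda>(i, j). of_real (1 / 2) * (?v c i * cnj (?v c j)))"
    have S: "quantum_state d (?S c)" if "c * cnj c = 1" for c
    proof (rule rank_one_quantum_state)
      have "(\<Sum>i<d. ?v c i * cnj (?v c i)) = (\<Sum>i<d. (if i = k then 1 else 0) + (if i = l then 1 else 0))"
        using False that by (intro sum.cong) auto
      also have "\<dots> = 2" using kl by (simp add: sum.distrib)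
      finally show "of_real (1 / 2) * (\<Sum>i<d. ?v c i * cnj (?v c i)) = 1" by simp
    qed simp
    \<comment> \<open>\<open>?S c\<close> is the projection onto e_k + c e_l, normalised by the 1/2.
      In \<open>?S 1\<close> plus i times \<open>?S i\<close> the entry at l, k cancels and the one
      at k, l adds up to 1; the last summand removes the diagonal (1 + i)/2.\<close>
    have "unit_mat d k l = ?S 1 + (\<i> \<cdot>\<^sub>m ?S \<i> + (- (1 + \<i>) / 2) \<cdot>\<^sub>m (unit_mat d k k + unit_mat d l l))"
      using False by (intro eq_matI) (auto simp: unit_mat_def field_simps)
    also have "E \<dots>"
      by (intro add scale state S unit_mat_quantum_state kl) auto
    finally show ?thesis .
  qed
  have "E (mat d d (\<lambda>p. if p \<in> K then X $$ p else 0))" if "finite K" "K \<subseteq> {..<d} \<times> {..<d}" for K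
    using that
  proof (induction K)
    case empty
    \<comment> \<open>The zero matrix starts the induction. In dimension 0 there are no states, so
      agreement comes from there being only one matrix; otherwise zero is a multiple of a unit
      matrix.\<close>
    have "E (0 \<cdot>\<^sub>m mat d d (\<lambda>p. 0))"
    proof (cases "d = 0")
      case True
      have "F (mat d d (\<lambda>p. 0)) \<in> carrier_mat d d" "G (mat d d (\<lambda>p. 0)) \<in> carrier_mat d d"
        using F G by (auto simp: linear_map_mat_def)
      then have "F (mat d d (\<lambda>p. 0)) = G (mat d d (\<lambda>p. 0))"
        using True by (intro eq_matI) auto
      then show ?thesis by (intro scale) (simp add: E_def)
    next
      case False
      have "0 \<cdot>\<^sub>m mat d d (\<lambda>p. 0) = 0 \<cdot>\<^sub>m unit_mat d 0 0" by (intro eq_matI) (auto simp: unit_mat_def)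
      then show ?thesis using scale[OF unit[of 0 0]] False by simp
    qed
    moreover have "0 \<cdot>\<^sub>m mat d d (\<lambda>p. 0) = mat d d (\<lambda>p. if p \<in> {} then X $$ p else 0)"
      by (intro eq_matI) auto
    ultimately show ?case by simp
  next
    case (insert p K)
    obtain k l where p: "p = (k, l)" "k < d" "l < d" using insert.prems by auto
    have "mat d d (\<lambda>q. if q \<in> insert p K then X $$ q else 0) =
      mat d d (\<lambda>q. if q \<in> K then X $$ q else 0) + X $$ p \<cdot>\<^sub>m unit_mat d k l"
      using insert.hyps p by (intro eq_matI) (auto simp: unit_mat_def)
    moreover have "E (mat d d (\<lambda>q. if q \<in> K then X $$ q else 0))" using insert by simp
    ultimately show ?case using add[OF _ scale[OF unit[OF p(2,3)]]] by simp
  qed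
  from this[of "{..<d} \<times> {..<d}"]
  have "E (mat d d (\<lambda>p. if p \<in> {..<d} \<times> {..<d} then X $$ p else 0))" by simp
  also have "mat d d (\<lambda>p. if p \<in> {..<d} \<times> {..<d} then X $$ p else 0) = X"
    using X by (intro eq_matI) auto
  finally show ?thesis by (simp add: E_def)
qed

text \<open>The complex order forces the quadratic form to be real. Reality at e_i, e_j, e_i + e_j
  and e_i + i e_j fixes the real and imaginary parts of the entries against their
  transposes.\<close>

lemma psd_hermitian:
  assumes "psd n A"
  shows "mat_adjoint A = A"
proof (rule eq_matI)
  have A: "A \<in> carrier_mat n n" using assms by (simp add: psd_def)
  fix i j assume "i < dim_row A" "j < dim_col A"
  then have ij: "i < n" "j < n" using A by auto
  have real: "Im (cnj a * a * A $$ (i, i) + cnj a * b * A $$ (i, j) + cnj b * a * A $$ (j, i)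
    + cnj b * b * A $$ (j, j)) = 0" for a b
  proof -
    define x where "x = (\<lambda>k. a * basis_vec i k + b * basis_vec j k)"
    have x: "x \<in> ell2 {..<n}" using ij by (auto simp: ell2_finite_iff basis_vec_def x_def)
    have "(A *\<^sub>v vec n x) \<bullet>c vec n x = (\<Sum>k<n. (\<Sum>l<n. A $$ (k, l) * x l) * cnj (x k))"
      using A by (auto simp: scalar_prod_def lessThan_atLeast0 intro!: sum.cong)
    also have "\<dots> = (\<Sum>k<n. \<Sum>l<n. cnj (x k) * A $$ (k, l) * x l)"
      by (simp add: sum_distrib_left sum_distrib_right mult_ac)
    also have "\<dots> = ell2_inner x (mat_op {..<n} (\<lambda>k l. A $$ (k, l)) x)"
      by (rule ell2_inner_mat_op[symmetric, OF _ x]) simp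
    also have "\<dots> = cnj a * a * A $$ (i, i) + cnj a * b * A $$ (i, j) + cnj b * a * A $$ (j, i)
      + cnj b * b * A $$ (j, j)"
      unfolding x_def using ij by (intro ell2_inner_mat_op_two) auto
    finally show ?thesis
      using assms unfolding psd_def by (metis less_eq_complex_def vec_carrier zero_complex.simps(2))
  qed
  have "cnj (A $$ (j, i)) = A $$ (i, j)"
    using real[of 1 0] real[of 0 1] real[of 1 1] real[of 1 \<i>] by (simp add: complex_eq_iff)
  then show "mat_adjoint A $$ (i, j) = A $$ (i, j)" using A ij by simp
qed (use assms in \<open>auto simp: psd_def\<close>)

lemma trace_mat_mult_commute:
  assumes "A \<in> carrier_mat n m" "B \<in> carrier_mat m n"
  shows "trace_mat (A * B) = trace_mat (B * A)"
proof -
  have "trace_mat (A * B) = (\<Sum>i<n. \<Sum>j<m. A $$ (i, j) * B $$ (j, i))"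
    using assms by (simp add: trace_mat_def index_mat_mult_sum[OF assms] del: index_mult_mat(1))
  also have "\<dots> = (\<Sum>j<m. \<Sum>i<n. B $$ (j, i) * A $$ (i, j))"
    by (subst sum.swap) (simp add: mult.commute)
  also have "\<dots> = trace_mat (B * A)"
    using assms by (simp add: trace_mat_def index_mat_mult_sum[OF assms(2,1)] del: index_mult_mat(1))
  finally show ?thesis .
qed

text \<open>A diagonal value is the quadratic form of the state at a column of \<open>Q\<close>, so
  it is nonnegative and in particular real. Cyclicity of the trace gives the total weight 1.\<close>

lemma quantum_state_diagonalisation:
  assumes "quantum_state n \<sigma>"
  obtains Q l where "unitary_mat n Q" "mat_adjoint Q * \<sigma> * Q = mat_diag n (\<lambda>i. complex_of_real (l i))"
    "\<And>i. i < n \<Longrightarrow> 0 \<le> l i" "(\<Sum>i<n. l i) = 1"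
proof -
  have psd: "psd n \<sigma>" and tr: "trace_mat \<sigma> = 1" and \<sigma>: "\<sigma> \<in> carrier_mat n n"
    using assms by (auto simp: quantum_state_def psd_def)
  obtain Q \<mu> where Q: "unitary_mat n Q" and D: "mat_adjoint Q * \<sigma> * Q = mat_diag n \<mu>"
    using hermitian_unitary_diagonalisation[OF \<sigma> psd_hermitian[OF psd]] by blast
  have Qc: "Q \<in> carrier_mat n n" "mat_adjoint Q \<in> carrier_mat n n" using Q by (auto simp: unitary_mat_def)
  have D': "mat_adjoint Q * (\<sigma> * Q) = mat_diag n \<mu>" using D assoc_mult_square[OF Qc(2) \<sigma> Qc(1)] by simp
  have pos: "0 \<le> \<mu> i" if i: "i < n" for i
  proof -
    have "\<mu> i = (mat_adjoint Q * (\<sigma> * Q)) $$ (i, i)" using i by (simp add: D' mat_diag_def del: index_mult_mat)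
    also have "\<dots> = (\<Sum>k<n. mat_adjoint Q $$ (i, k) * (\<sigma> * Q) $$ (k, i))"
      by (rule index_mat_mult_sum[OF Qc(2) mult_square_carrier[OF \<sigma> Qc(1)] i i])
    also have "\<dots> = (\<sigma> *\<^sub>v col Q i) \<bullet>c col Q i"
      using i Qc \<sigma> by (auto simp: scalar_prod_def[of "\<sigma> *\<^sub>v _"] lessThan_atLeast0 intro!: sum.cong)
    also have "\<dots> \<ge> 0" using psd Qc(1) col_dim[of Q i] by (simp add: psd_def)
    finally show ?thesis .
  qed
  have \<mu>: "\<mu> i = of_real (Re (\<mu> i))" if "i < n" for i
    using pos[OF that] by (simp add: complex_eq_iff less_eq_complex_def)
  show ?thesis
  proof (rule that[OF Q, of "\<lambda>i. Re (\<mu> i)"])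
    show "mat_adjoint Q * \<sigma> * Q = mat_diag n (\<lambda>i. complex_of_real (Re (\<mu> i)))"
      unfolding D using \<mu> by (intro eq_matI) (auto simp: mat_diag_def)
    show "0 \<le> Re (\<mu> i)" if "i < n" for i using pos[OF that] by (simp add: less_eq_complex_def)
    have "(\<Sum>i<n. \<mu> i) = trace_mat (mat_diag n \<mu>)" by (simp add: trace_mat_def mat_diag_def)
    also have "\<dots> = trace_mat (\<sigma> * Q * mat_adjoint Q)"
      unfolding D'[symmetric] by (rule trace_mat_mult_commute[OF Qc(2) mult_square_carrier[OF \<sigma> Qc(1)]])
    also have "\<dots> = 1"
      using Q tr \<sigma> Qc by (simp add: assoc_mult_square[OF \<sigma> Qc] unitary_mat_def)
    finally show "(\<Sum>i<n. Re (\<mu> i)) = 1" using Re_sum[of \<mu> "{..<n}"] by simp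
  qed
qed

section \<open>Factorization through block diagonal operators\<close>

lemma op_sum_cong: "(\<And>k. k \<in> K \<Longrightarrow> F k = G k) \<Longrightarrow> op_sum F K = op_sum G K"
  by (simp add: op_sum_def)

lemma scaled_one_mat_op:
  assumes "finite J"
  shows "op_scale c (op_one J) = mat_op J (\<lambda>i j. if i = j then c else 0)"
  unfolding op_one_mat_op[OF assms] op_scale_mat_op[OF assms] by (rule mat_op_eqI[OF assms]) simp

text \<open>The function \<open>w a b\<close> is the matrix over \<open>J\<close> of the entry of
  \<open>u\<close> at a, b. With all products multiplied out, membership in the algebra is
  \<open>block\<close>, unitarity is \<open>unit1\<close> and \<open>unit2\<close>, and the
  factorization identity is \<open>rep\<close>, so only finite sums remain to be checked.\<close>

lemma factorizable_block_unitary: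
  fixes l :: "nat \<Rightarrow> real" and w :: "nat \<Rightarrow> nat \<Rightarrow> nat \<Rightarrow> nat \<Rightarrow> complex"
  assumes qm: "quantum_map d \<Phi>"
    and fin: "finite J" and pos: "\<And>r. r \<in> J \<Longrightarrow> 0 < l r" and sum: "sum l J = 1"
    and block: "\<And>a b r t. a < d \<Longrightarrow> b < d \<Longrightarrow> r \<in> J \<Longrightarrow> t \<in> J \<Longrightarrow> l r \<noteq> l t \<Longrightarrow> w a b r t = 0"
    and unit1: "\<And>a b r s. a < d \<Longrightarrow> b < d \<Longrightarrow> r \<in> J \<Longrightarrow> s \<in> J \<Longrightarrow>
      (\<Sum>k<d. \<Sum>t\<in>J. w a k r t * cnj (w b k s t)) = (if a = b \<and> r = s then 1 else 0)"
    and unit2: "\<And>a b r s. a < d \<Longrightarrow> b < d \<Longrightarrow> r \<in> J \<Longrightarrow> s \<in> J \<Longrightarrow>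
      (\<Sum>k<d. \<Sum>t\<in>J. cnj (w k a t r) * w k b t s) = (if a = b \<and> r = s then 1 else 0)"
    and rep: "\<And>X i j. X \<in> carrier_mat d d \<Longrightarrow> i < d \<Longrightarrow> j < d \<Longrightarrow>
      \<Phi> X $$ (i, j) = (\<Sum>r\<in>J. of_real (l r) *
        (\<Sum>h<d. \<Sum>t\<in>J. (\<Sum>k<d. w i k r t * X $$ (k, h)) * cnj (w j h r t)))"
  shows "factorizable d \<Phi>"
proof -
  define N where "N = block_algebra J l"
  define \<tau> where "\<tau> = weighted_trace J l"
  define u where "u = mat d d (\<lambda>(a, b). mat_op J (w a b))"
  note op_simps = op_adjoint_mat_op[OF fin] comp_mat_op[OF fin]
    op_sum_mat_op[OF fin finite_lessThan] scaled_one_mat_op[OF fin]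
  have \<Phi>c: "\<Phi> X \<in> carrier_mat d d" if "X \<in> carrier_mat d d" for X
    using qm that by (simp add: quantum_map_def linear_map_mat_def)
  have u_dim: "u \<in> carrier_mat d d" by (simp add: u_def)
  have u: "u $$ (a, b) = mat_op J (w a b)" if "a < d" "b < d" for a b
    using that by (simp add: u_def)
  have uadj: "tensor_adjoint J d u $$ (a, b) = mat_op J (\<lambda>r t. cnj (w b a t r))" if "a < d" "b < d" for a b
    using that by (simp add: tensor_adjoint_def u op_simps)
  have "tensor_mult d u (tensor_adjoint J d u) = tensor_embed J d (1\<^sub>m d)"
  proof (rule eq_matI)
    fix a b assume "a < dim_row (tensor_embed J d (1\<^sub>m d))" "b < dim_col (tensor_embed J d (1\<^sub>m d))"
    then have ab: "a < d" "b < d" by (auto simp: tensor_embed_def)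
    have "tensor_mult d u (tensor_adjoint J d u) $$ (a, b) =
      op_sum (\<lambda>k. mat_op J (w a k) \<circ> mat_op J (\<lambda>r t. cnj (w b k t r))) {..<d}"
      using ab by (simp add: tensor_mult_def) (intro op_sum_cong, simp add: u uadj)
    also have "\<dots> = mat_op J (\<lambda>r s. \<Sum>k<d. \<Sum>t\<in>J. w a k r t * cnj (w b k s t))"
      unfolding op_simps ..
    also have "\<dots> = mat_op J (\<lambda>r s. if r = s then 1\<^sub>m d $$ (a, b) else 0)"
      using ab by (intro mat_op_eqI[OF fin]) (simp add: unit1)
    finally show "tensor_mult d u (tensor_adjoint J d u) $$ (a, b) = tensor_embed J d (1\<^sub>m d) $$ (a, b)"
      using ab by (simp add: tensor_embed_def op_simps)
  qed (auto simp: tensor_mult_def tensor_embed_def)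
  moreover have "tensor_mult d (tensor_adjoint J d u) u = tensor_embed J d (1\<^sub>m d)"
  proof (rule eq_matI)
    fix a b assume "a < dim_row (tensor_embed J d (1\<^sub>m d))" "b < dim_col (tensor_embed J d (1\<^sub>m d))"
    then have ab: "a < d" "b < d" by (auto simp: tensor_embed_def)
    have "tensor_mult d (tensor_adjoint J d u) u $$ (a, b) =
      op_sum (\<lambda>k. mat_op J (\<lambda>r t. cnj (w k a t r)) \<circ> mat_op J (w k b)) {..<d}"
      using ab by (simp add: tensor_mult_def) (intro op_sum_cong, simp add: u uadj)
    also have "\<dots> = mat_op J (\<lambda>r s. \<Sum>k<d. \<Sum>t\<in>J. cnj (w k a t r) * w k b t s)"
      unfolding op_simps ..
    also have "\<dots> = mat_op J (\<lambda>r s. if r = s then 1\<^sub>m d $$ (a, b) else 0)"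
      using ab by (intro mat_op_eqI[OF fin]) (simp add: unit2)
    finally show "tensor_mult d (tensor_adjoint J d u) u $$ (a, b) = tensor_embed J d (1\<^sub>m d) $$ (a, b)"
      using ab by (simp add: tensor_embed_def op_simps)
  qed (auto simp: tensor_mult_def tensor_embed_def)
  moreover have "u \<in> tensor_carrier d N"
    using u_dim by (auto simp: tensor_carrier_def u N_def mat_op_block_algebra_iff[OF fin] intro: block)
  ultimately have unitary: "tensor_unitary J d N u" by (simp add: tensor_unitary_def)
  have fact: "\<Phi> X = map_mat \<tau> (tensor_mult d (tensor_mult d u (tensor_embed J d X)) (tensor_adjoint J d u))"
    if X: "X \<in> carrier_mat d d" for X
  proof (rule eq_matI)
    let ?M = "tensor_mult d (tensor_mult d u (tensor_embed J d X)) (tensor_adjoint J d u)"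
    fix i j assume "i < dim_row (map_mat \<tau> ?M)" "j < dim_col (map_mat \<tau> ?M)"
    then have ij: "i < d" "j < d" by (auto simp: tensor_mult_def)
    have uX: "tensor_mult d u (tensor_embed J d X) $$ (i, h) =
      mat_op J (\<lambda>r t. \<Sum>k<d. w i k r t * X $$ (k, h))" if h: "h < d" for h
    proof -
      have "tensor_mult d u (tensor_embed J d X) $$ (i, h) =
        op_sum (\<lambda>k. mat_op J (w i k) \<circ> op_scale (X $$ (k, h)) (op_one J)) {..<d}"
        using ij h by (simp add: tensor_mult_def) (intro op_sum_cong, simp add: u tensor_embed_def)
      also have "\<dots> = mat_op J (\<lambda>r s. \<Sum>k<d. \<Sum>t\<in>J. w i k r t * (if t = s then X $$ (k, h) else 0))"
        unfolding op_simps ..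
      also have "\<dots> = mat_op J (\<lambda>r t. \<Sum>k<d. w i k r t * X $$ (k, h))"
        using fin by (intro mat_op_eqI[OF fin] sum.cong refl) (simp add: if_distrib cong: if_cong)
      finally show ?thesis .
    qed
    have "?M $$ (i, j) = op_sum (\<lambda>h. mat_op J (\<lambda>r t. \<Sum>k<d. w i k r t * X $$ (k, h))
        \<circ> mat_op J (\<lambda>r t. cnj (w j h t r))) {..<d}"
      using ij by (simp add: tensor_mult_def[of d "tensor_mult d u (tensor_embed J d X)"])
        (intro op_sum_cong, simp add: uX uadj)
    also have "\<dots> = mat_op J (\<lambda>r s. \<Sum>h<d. \<Sum>t\<in>J. (\<Sum>k<d. w i k r t * X $$ (k, h)) * cnj (w j h s t))"
      unfolding op_simps ..
    finally have "\<tau> (?M $$ (i, j)) = \<Phi> X $$ (i, j)"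
      by (simp add: \<tau>_def weighted_trace_mat_op[OF fin] rep[OF X ij])
    then show "\<Phi> X $$ (i, j) = map_mat \<tau> ?M $$ (i, j)" using ij by (simp add: tensor_mult_def)
  qed (use \<Phi>c[OF that] in \<open>auto simp: tensor_mult_def\<close>)
  \<comment> \<open>Unitality is derived, not assumed: at the identity \<open>rep\<close> reduces
    through \<open>unit1\<close> to the Kronecker delta times the total weight, which is 1.\<close>
  have one: "\<Phi> (1\<^sub>m d) = 1\<^sub>m d"
  proof (rule eq_matI)
    fix i j assume "i < dim_row (1\<^sub>m d :: complex mat)" "j < dim_col (1\<^sub>m d :: complex mat)"
    then have ij: "i < d" "j < d" by auto
    have "\<Phi> (1\<^sub>m d) $$ (i, j) = (\<Sum>r\<in>J. of_real (l r) *
        (\<Sum>h<d. \<Sum>t\<in>J. w i h r t * cnj (w j h r t)))"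
      unfolding rep[OF one_carrier_mat ij]
    proof (intro sum.cong refl arg_cong2[of _ _ _ _ "(*)"])
      fix r h t assume "h \<in> {..<d}"
      then have "(\<Sum>k<d. w i k r t * 1\<^sub>m d $$ (k, h)) = (\<Sum>k<d. w i k r t * (if k = h then 1 else 0))"
        by (intro sum.cong) auto
      also have "\<dots> = w i h r t"
        using \<open>h \<in> {..<d}\<close> by (intro sum_if_eq(1)) auto
      finally show "(\<Sum>k<d. w i k r t * 1\<^sub>m d $$ (k, h)) = w i h r t" .
    qed
    also have "\<dots> = of_real (sum l J) * (if i = j then 1 else 0)"
      using ij by (simp add: unit1)
    finally show "\<Phi> (1\<^sub>m d) $$ (i, j) = 1\<^sub>m d $$ (i, j)" using ij sum by simp
  qed (use \<Phi>c[OF one_carrier_mat] in auto)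
  have "von_neumann_algebra J N" unfolding N_def by (rule von_neumann_block_algebra[OF fin])
  moreover have "faithful_normal_tracial_state J N \<tau>"
    unfolding faithful_normal_tracial_state_def N_def \<tau>_def
    by (intro conjI state_on_weighted_trace faithful_on_weighted_trace tracial_on_weighted_trace
        normal_on_weighted_trace fin sum) (auto intro: pos less_imp_le)
  ultimately show ?thesis
    unfolding factorizable_def using qm one unitary fact by blast
qed

text \<open>
  Expanding the square, the rows and columns contribute \<open>\<Sum>r. (l r)\<^sup>2\<close> each per index of
  the first factor, and preservation of \<open>l\<close> makes the cross term cancel them.
\<close>

lemma weight_preserving_imp_block_diagonal:
  fixes N :: "nat \<Rightarrow> nat \<Rightarrow> nat \<Rightarrow> nat \<Rightarrow> real"
  assumes nonneg: "\<And>a b r t. 0 \<le> N a b r t"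
    and row: "\<And>a r. a < d \<Longrightarrow> r < n \<Longrightarrow> (\<Sum>b<d. \<Sum>t<n. N a b r t) = 1"
    and col: "\<And>b t. b < d \<Longrightarrow> t < n \<Longrightarrow> (\<Sum>a<d. \<Sum>r<n. N a b r t) = 1"
    and weight: "\<And>b r. b < d \<Longrightarrow> r < n \<Longrightarrow> (\<Sum>a<d. \<Sum>t<n. N a b r t * l t) = l r"
    and ab: "a < d" "b < d" "r < n" "t < n" and l: "l r \<noteq> l t"
  shows "N a b r t = 0"
proof -
  define S where "S = (\<Sum>r<n. (l r)\<^sup>2)"
  have rows: "(\<Sum>a<d. \<Sum>b<d. \<Sum>r<n. \<Sum>t<n. N a b r t * (l r)\<^sup>2) = d * S"
  proof -
    have "(\<Sum>b<d. \<Sum>r<n. \<Sum>t<n. N a b r t * (l r)\<^sup>2) = S" if "a < d" for a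
    proof -
      have "(\<Sum>b<d. \<Sum>r<n. \<Sum>t<n. N a b r t * (l r)\<^sup>2) = (\<Sum>r<n. \<Sum>b<d. \<Sum>t<n. N a b r t * (l r)\<^sup>2)"
        by (rule sum.swap)
      also have "\<dots> = S" using row[OF that] by (simp add: S_def flip: sum_distrib_right)
      finally show ?thesis .
    qed
    then show ?thesis by simp
  qed
  have cols: "(\<Sum>a<d. \<Sum>b<d. \<Sum>r<n. \<Sum>t<n. N a b r t * (l t)\<^sup>2) = d * S"
  proof -
    have "(\<Sum>a<d. \<Sum>b<d. \<Sum>r<n. \<Sum>t<n. N a b r t * (l t)\<^sup>2) = (\<Sum>b<d. \<Sum>a<d. \<Sum>r<n. \<Sum>t<n. N a b r t * (l t)\<^sup>2)"
      by (rule sum.swap)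
    also have "\<dots> = (\<Sum>b<d. \<Sum>a<d. \<Sum>t<n. \<Sum>r<n. N a b r t * (l t)\<^sup>2)"
      by (rule sum.cong[OF refl], rule sum.cong[OF refl], rule sum.swap)
    also have "\<dots> = (\<Sum>b<d. \<Sum>t<n. \<Sum>a<d. \<Sum>r<n. N a b r t * (l t)\<^sup>2)"
      by (rule sum.cong[OF refl], rule sum.swap)
    also have "\<dots> = d * S" using col by (simp add: S_def flip: sum_distrib_right)
    finally show ?thesis .
  qed
  \<comment> \<open>For fixed b and r, summing over a and t first lets \<open>weight\<close> return
    \<open>l r\<close>; with the remaining factor \<open>l r\<close> each b contributes the sum of
    squares \<open>S\<close>.\<close>
  have cross: "(\<Sum>a<d. \<Sum>b<d. \<Sum>r<n. \<Sum>t<n. N a b r t * l t * l r) = d * S"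
  proof -
    have "(\<Sum>a<d. \<Sum>b<d. \<Sum>r<n. \<Sum>t<n. N a b r t * l t * l r) = (\<Sum>b<d. \<Sum>a<d. \<Sum>r<n. \<Sum>t<n. N a b r t * l t * l r)"
      by (rule sum.swap)
    also have "\<dots> = (\<Sum>b<d. \<Sum>r<n. \<Sum>a<d. \<Sum>t<n. N a b r t * l t * l r)"
      by (rule sum.cong[OF refl], rule sum.swap)
    also have "\<dots> = d * S" using weight by (simp add: S_def power2_eq_square flip: sum_distrib_right)
    finally show ?thesis .
  qed
  \<comment> \<open>For \<open>N\<close> the squared moduli of the coefficients of a unitary, the
    left side is the squared Hilbert-Schmidt norm of its commutator with 1 tensor diag(l).\<close>
  have "(\<Sum>a<d. \<Sum>b<d. \<Sum>r<n. \<Sum>t<n. N a b r t * (l r - l t)\<^sup>2) =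
    (\<Sum>a<d. \<Sum>b<d. \<Sum>r<n. \<Sum>t<n. N a b r t * (l r)\<^sup>2 + N a b r t * (l t)\<^sup>2 - 2 * (N a b r t * l t * l r))"
    by (simp add: power2_diff algebra_simps)
  also have "\<dots> = d * S + d * S - 2 * (d * S)"
    unfolding sum.distrib sum_subtractf sum_distrib_left[symmetric] rows cols cross ..
  finally have 0: "(\<Sum>a<d. \<Sum>b<d. \<Sum>r<n. \<Sum>t<n. N a b r t * (l r - l t)\<^sup>2) = 0" by simp
  have nn: "0 \<le> N a b r t * (l r - l t)\<^sup>2" for a b r t using nonneg by simp
  have "(\<Sum>b<d. \<Sum>r<n. \<Sum>t<n. N a b r t * (l r - l t)\<^sup>2) = 0"
    by (rule sum_nonneg_0[OF finite_lessThan _ 0]) (use ab in \<open>auto intro!: sum_nonneg nn\<close>)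
  then have "(\<Sum>r<n. \<Sum>t<n. N a b r t * (l r - l t)\<^sup>2) = 0"
    by (rule sum_nonneg_0[OF finite_lessThan, rotated]) (use ab in \<open>auto intro!: sum_nonneg nn\<close>)
  then have "(\<Sum>t<n. N a b r t * (l r - l t)\<^sup>2) = 0"
    by (rule sum_nonneg_0[OF finite_lessThan, rotated]) (use ab in \<open>auto intro!: sum_nonneg nn\<close>)
  then have "N a b r t * (l r - l t)\<^sup>2 = 0"
    by (rule sum_nonneg_0[OF finite_lessThan, rotated]) (use ab in \<open>auto intro!: nn\<close>)
  then show ?thesis using l by simp
qed

section \<open>Reduction to a diagonal catalyst and conclusion\<close>

lemma index_conj_kron_diag:
  assumes W: "W \<in> carrier_mat (d * n) (d * n)" and X: "X \<in> carrier_mat d d"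
    and *: "i < d" "r < n" "j < d" "s < n"
  shows "(W * kron X (mat_diag n \<mu>) * mat_adjoint W) $$ (i * n + r, j * n + s) =
    (\<Sum>h<d. \<Sum>t<n. (\<Sum>k<d. W $$ (i * n + r, k * n + t) * X $$ (k, h)) * \<mu> t * cnj (W $$ (j * n + s, h * n + t)))"
proof -
  note idx = block_index_less[of _ d _ n]
  have D: "mat_diag n \<mu> \<in> carrier_mat n n" by simp
  have K: "kron X (mat_diag n \<mu>) \<in> carrier_mat (d * n) (d * n)" using X by auto
  have WK: "(W * kron X (mat_diag n \<mu>)) $$ (i * n + r, h * n + t) =
    (\<Sum>k<d. W $$ (i * n + r, k * n + t) * X $$ (k, h)) * \<mu> t" if "h < d" "t < n" for h t
  proof -
    have "(W * kron X (mat_diag n \<mu>)) $$ (i * n + r, h * n + t) =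
      (\<Sum>k<d. \<Sum>q<n. W $$ (i * n + r, k * n + q) * (X $$ (k, h) * mat_diag n \<mu> $$ (q, t)))"
      using * that idx by (subst index_mult_mat_block[OF W K]) (auto simp: index_kron[OF X D])
    also have "\<dots> = (\<Sum>k<d. \<Sum>q<n. if q = t then W $$ (i * n + r, k * n + q) * (X $$ (k, h) * \<mu> t) else 0)"
      using that by (intro sum.cong) (auto simp: mat_diag_def)
    also have "\<dots> = (\<Sum>k<d. W $$ (i * n + r, k * n + t) * (X $$ (k, h) * \<mu> t))"
      using that by simp
    finally show ?thesis by (simp add: sum_distrib_right mult.assoc)
  qed
  show ?thesis
    using * idx W by (subst index_mult_mat_block[OF mult_square_carrier[OF W K] mat_adjoint_carrier[OF W]])
      (auto simp: WK simp del: index_mult_mat)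
qed

text \<open>On the catalyst, \<open>Q\<close> first turns the diagonal D into
  \<open>\<sigma>\<close>; after \<open>U\<close> its marginal is \<open>V\<close> conjugating
  \<open>\<sigma>\<close>, that is \<open>R = V * Q\<close> conjugating D, and the adjoint of
  \<open>R\<close> undoes this. So the catalyst returns exactly to D, while the channel does not see
  the final rotation.\<close>

lemma catalytic_diagonal_catalyst:
  assumes "catalytic d \<Phi>"
  obtains n W l where "unitary_mat (d * n) W" "\<And>r. r < n \<Longrightarrow> 0 \<le> l r" "(\<Sum>r<n. l r) = 1"
    "\<And>\<rho>. quantum_state d \<rho> \<Longrightarrow>
      ptrace_B d n (W * kron \<rho> (mat_diag n (\<lambda>r. complex_of_real (l r))) * mat_adjoint W) = \<Phi> \<rho>"
    "\<And>\<rho>. quantum_state d \<rho> \<Longrightarrow>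
      ptrace_A d n (W * kron \<rho> (mat_diag n (\<lambda>r. complex_of_real (l r))) * mat_adjoint W)
        = mat_diag n (\<lambda>r. complex_of_real (l r))"
proof -
  obtain n \<sigma> U V where \<sigma>: "quantum_state n \<sigma>" and U: "unitary_mat (d * n) U" and V: "unitary_mat n V"
    and PB: "\<And>\<rho>. quantum_state d \<rho> \<Longrightarrow> ptrace_B d n (U * kron \<rho> \<sigma> * mat_adjoint U) = \<Phi> \<rho>"
    and PA: "\<And>\<rho>. quantum_state d \<rho> \<Longrightarrow>
      ptrace_A d n (U * kron \<rho> \<sigma> * mat_adjoint U) = V * \<sigma> * mat_adjoint V"
    using assms unfolding catalytic_def by blast
  obtain Q l where Q: "unitary_mat n Q" and D: "mat_adjoint Q * \<sigma> * Q = mat_diag n (\<lambda>i. complex_of_real (l i))"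
    and l: "\<And>i. i < n \<Longrightarrow> 0 \<le> l i" "(\<Sum>i<n. l i) = 1"
    using quantum_state_diagonalisation[OF \<sigma>] by metis
  define D' where "D' = mat_diag n (\<lambda>i. complex_of_real (l i))"
  define R where "R = V * Q"
  define KQ where "KQ = kron (1\<^sub>m d) Q"
  define KR where "KR = kron (1\<^sub>m d) R"
  define W where "W = mat_adjoint KR * U * KQ"
  have R: "unitary_mat n R" unfolding R_def by (rule unitary_mat_mult[OF V Q])
  have KQ: "unitary_mat (d * n) KQ" and KR: "unitary_mat (d * n) KR"
    unfolding KQ_def KR_def by (rule unitary_kron_one[OF Q], rule unitary_kron_one[OF R])
  have c: "\<sigma> \<in> carrier_mat n n" "Q \<in> carrier_mat n n" "V \<in> carrier_mat n n" "D' \<in> carrier_mat n n"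
    "R \<in> carrier_mat n n"
    using \<sigma> Q V R by (auto simp: quantum_state_def psd_def unitary_mat_def D'_def)
  note c' = c mat_adjoint_carrier[OF c(2)] mat_adjoint_carrier[OF c(3)]
  have C: "U \<in> carrier_mat (d * n) (d * n)" "KQ \<in> carrier_mat (d * n) (d * n)" "KR \<in> carrier_mat (d * n) (d * n)"
    using U KQ KR by (auto simp: unitary_mat_def)
  note C' = C C[THEN mat_adjoint_carrier]
  have W: "unitary_mat (d * n) W"
    unfolding W_def by (intro unitary_mat_mult unitary_mat_adjoint KR U KQ)
  have KR': "mat_adjoint KR = kron (1\<^sub>m d) (mat_adjoint R)"
    unfolding KR_def using c by (simp add: mat_adjoint_kron[of _ d _ n])
  have QDQ: "Q * D' * mat_adjoint Q = \<sigma>"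
  proof -
    have "Q * D' * mat_adjoint Q = (Q * mat_adjoint Q) * \<sigma> * (Q * mat_adjoint Q)"
      unfolding D'_def D[symmetric] using c' by (simp add: assoc_mult_square[of _ n] mult_square_carrier[of _ n])
    then show ?thesis using Q c by (simp add: unitary_mat_def)
  qed
  have conj: "W * kron \<rho> D' * mat_adjoint W =
      kron (1\<^sub>m d) (mat_adjoint R) * (U * kron \<rho> \<sigma> * mat_adjoint U) * kron (1\<^sub>m d) R"
    if \<rho>: "\<rho> \<in> carrier_mat d d" for \<rho>
  proof -
    have "KQ * kron \<rho> D' * mat_adjoint KQ = kron \<rho> \<sigma>"
      unfolding KQ_def using c' \<rho> QDQ
      by (simp add: mat_adjoint_kron[of _ d _ n] kron_mult[of _ d _ _ n] mult_square_carrier[of _ n])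
    then have "mat_adjoint KR * (U * (KQ * kron \<rho> D' * mat_adjoint KQ) * mat_adjoint U) * KR =
      mat_adjoint KR * (U * kron \<rho> \<sigma> * mat_adjoint U) * KR" by simp
    moreover have "W * kron \<rho> D' * mat_adjoint W =
      mat_adjoint KR * (U * (KQ * kron \<rho> D' * mat_adjoint KQ) * mat_adjoint U) * KR"
      unfolding W_def using C' kron_carrier[OF \<rho> c(4)]
      by (simp add: mat_adjoint_mult[of _ "d * n" "d * n" _ "d * n"] assoc_mult_square[of _ "d * n"] mult_square_carrier[of _ "d * n"])
    ultimately show ?thesis
      unfolding KR'[symmetric] KR_def[symmetric] by simp
  qed
  have Z: "U * kron \<rho> \<sigma> * mat_adjoint U \<in> carrier_mat (d * n) (d * n)" if "\<rho> \<in> carrier_mat d d" for \<rho>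
    using C' kron_carrier[OF that c(1)] by (intro mult_square_carrier)
  have state_c: "\<rho> \<in> carrier_mat d d" if "quantum_state d \<rho>" for \<rho>
    using that by (simp add: quantum_state_def psd_def)
  show ?thesis
  proof (rule that[OF W l])
    fix \<rho> assume \<rho>: "quantum_state d \<rho>"
    show "ptrace_B d n (W * kron \<rho> (mat_diag n (\<lambda>r. complex_of_real (l r))) * mat_adjoint W) = \<Phi> \<rho>"
      using conj[OF state_c[OF \<rho>]] ptrace_B_kron_conj[OF Z[OF state_c[OF \<rho>]] R] PB[OF \<rho>]
      by (simp add: D'_def)
    have "ptrace_A d n (W * kron \<rho> D' * mat_adjoint W) = mat_adjoint R * (V * \<sigma> * mat_adjoint V) * R"
      using conj[OF state_c[OF \<rho>]] PA[OF \<rho>]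
        ptrace_A_kron_conj[OF Z[OF state_c[OF \<rho>]] mat_adjoint_carrier[OF c(5)] c(5)] by simp
    also have "\<dots> = mat_adjoint Q * (mat_adjoint V * V) * \<sigma> * (mat_adjoint V * V) * Q"
      unfolding R_def using c'
      by (simp add: mat_adjoint_mult[of _ n n _ n] assoc_mult_square[of _ n] mult_square_carrier[of _ n])
    also have "\<dots> = D'"
      using V c' D by (simp add: unitary_mat_def D'_def)
    finally show "ptrace_A d n (W * kron \<rho> (mat_diag n (\<lambda>r. complex_of_real (l r))) * mat_adjoint W)
        = mat_diag n (\<lambda>r. complex_of_real (l r))" by (simp add: D'_def)
  qed
qed

theorem mainTheorem2:
  fixes d :: nat and \<Phi> :: "complex mat \<Rightarrow> complex mat"
  assumes "quantum_map d \<Phi>" and "catalytic d \<Phi>"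
  shows "factorizable d \<Phi>"
proof -
  obtain n W l where WU: "unitary_mat (d * n) W" and l0: "\<And>r. r < n \<Longrightarrow> 0 \<le> l r"
    and l1: "(\<Sum>r<n. l r) = (1 :: real)"
    and PB: "\<And>\<rho>. quantum_state d \<rho> \<Longrightarrow>
      ptrace_B d n (W * kron \<rho> (mat_diag n (\<lambda>r. complex_of_real (l r))) * mat_adjoint W) = \<Phi> \<rho>"
    and PA: "\<And>\<rho>. quantum_state d \<rho> \<Longrightarrow>
      ptrace_A d n (W * kron \<rho> (mat_diag n (\<lambda>r. complex_of_real (l r))) * mat_adjoint W)
        = mat_diag n (\<lambda>r. complex_of_real (l r))"
    using catalytic_diagonal_catalyst[OF assms(2)] by metis
  have W: "W \<in> carrier_mat (d * n) (d * n)" using WU by (simp add: unitary_mat_def)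
  \<comment> \<open>The A-indices a, b come first and the B-indices r, t second, so
    \<open>w a b\<close> is directly the operator-valued entry of \<open>W\<close>.\<close>
  define w where "w a b r t = W $$ (a * n + r, b * n + t)" for a b r t
  note idx = block_index_less[of _ d _ n]
  note index_conj = index_conj_kron_diag[OF W, folded w_def]
  have row: "(\<Sum>k<d. \<Sum>t<n. w a k r t * cnj (w b k s t)) = (if a = b \<and> r = s then 1 else 0)"
    if "a < d" "b < d" "r < n" "s < n" for a b r s
  proof -
    have "(\<Sum>k<d. \<Sum>t<n. w a k r t * cnj (w b k s t)) = (W * mat_adjoint W) $$ (a * n + r, b * n + s)"
      using that idx W by (subst index_mult_mat_block[OF W mat_adjoint_carrier[OF W]]) (auto simp: w_def)
    also have "\<dots> = (if a = b \<and> r = s then 1 else 0)"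
      using WU that idx block_index_eq_iff by (auto simp: unitary_mat_def)
    finally show ?thesis .
  qed
  have col: "(\<Sum>k<d. \<Sum>t<n. cnj (w k a t r) * w k b t s) = (if a = b \<and> r = s then 1 else 0)"
    if "a < d" "b < d" "r < n" "s < n" for a b r s
  proof -
    have "(\<Sum>k<d. \<Sum>t<n. cnj (w k a t r) * w k b t s) = (mat_adjoint W * W) $$ (a * n + r, b * n + s)"
      using that idx W by (subst index_mult_mat_block[OF mat_adjoint_carrier[OF W] W]) (auto simp: w_def)
    also have "\<dots> = (if a = b \<and> r = s then 1 else 0)"
      using WU that idx block_index_eq_iff by (auto simp: unitary_mat_def)
    finally show ?thesis .
  qed
  have norm_sq: "z * cnj z = of_real ((cmod z)\<^sup>2)" "cnj z * z = of_real ((cmod z)\<^sup>2)" for z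
    by (simp_all only: complex_norm_square mult.commute)
  \<comment> \<open>Basis inputs \<open>unit_mat d b b\<close> suffice: entry r, r of the catalyst
    marginal is the weighted sum of squared coefficients with second index b.\<close>
  have weight: "(\<Sum>a<d. \<Sum>t<n. (cmod (w a b r t))\<^sup>2 * l t) = l r" if b: "b < d" and r: "r < n" for b r
  proof -
    let ?Z = "W * kron (unit_mat d b b) (mat_diag n (\<lambda>r. complex_of_real (l r))) * mat_adjoint W"
    have "complex_of_real (l r) = ptrace_A d n ?Z $$ (r, r)"
      unfolding PA[OF unit_mat_quantum_state[OF b]] using r by (simp add: mat_diag_def)
    also have "\<dots> = (\<Sum>a<d. ?Z $$ (a * n + r, a * n + r))"
      using r by (simp add: ptrace_A_def)
    also have "\<dots> = (\<Sum>a<d. \<Sum>h<d. if h = b then \<Sum>t<n. of_real ((cmod (w a h r t))\<^sup>2 * l t) else 0)"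
    proof (intro sum.cong refl)
      fix a assume "a \<in> {..<d}"
      then have "?Z $$ (a * n + r, a * n + r) = (\<Sum>h<d. \<Sum>t<n.
          (\<Sum>k<d. w a k r t * unit_mat d b b $$ (k, h)) * of_real (l t) * cnj (w a h r t))"
        using r by (simp add: index_conj)
      also have "\<dots> = (\<Sum>h<d. if h = b then \<Sum>t<n. of_real ((cmod (w a h r t))\<^sup>2 * l t) else 0)"
      proof (intro sum.cong refl)
        fix h assume h: "h \<in> {..<d}"
        have "(\<Sum>k<d. w a k r t * unit_mat d b b $$ (k, h)) = (if h = b then w a h r t else 0)" for t
        proof -
          have "(\<Sum>k<d. w a k r t * unit_mat d b b $$ (k, h)) = (\<Sum>k<d. if k = b then (if h = b then w a h r t else 0) else 0)"
            using h by (intro sum.cong) (auto simp: unit_mat_def)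
          then show ?thesis using b by simp
        qed
        then show "(\<Sum>t<n. (\<Sum>k<d. w a k r t * unit_mat d b b $$ (k, h)) * of_real (l t) * cnj (w a h r t))
          = (if h = b then \<Sum>t<n. of_real ((cmod (w a h r t))\<^sup>2 * l t) else 0)"
          by (simp add: norm_sq[symmetric] mult_ac del: of_real_power)
      qed
      finally show "?Z $$ (a * n + r, a * n + r) =
        (\<Sum>h<d. if h = b then \<Sum>t<n. of_real ((cmod (w a h r t))\<^sup>2 * l t) else 0)" .
    qed
    also have "\<dots> = of_real (\<Sum>a<d. \<Sum>t<n. (cmod (w a b r t))\<^sup>2 * l t)" using b by simp
    finally show ?thesis by (simp only: of_real_eq_iff)
  qed
  \<comment> \<open>In coordinates, this is the commutation of \<open>W\<close> with 1 tensor
    D.\<close>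
  have block: "w a b r t = 0" if "a < d" "b < d" "r < n" "t < n" "l r \<noteq> l t" for a b r t
  proof -
    have "(cmod (w a b r t))\<^sup>2 = 0"
    proof (rule weight_preserving_imp_block_diagonal[where N = "\<lambda>a b r t. (cmod (w a b r t))\<^sup>2" and d = d and n = n and l = l])
      fix a r assume "a < d" "r < n"
      then have "complex_of_real (\<Sum>b<d. \<Sum>t<n. (cmod (w a b r t))\<^sup>2) = of_real 1"
        using row[of a a r r] by (simp only: norm_sq of_real_sum) simp
      then show "(\<Sum>b<d. \<Sum>t<n. (cmod (w a b r t))\<^sup>2) = 1" by (simp only: of_real_eq_iff)
    next
      fix b t assume "b < d" "t < n"
      then have "complex_of_real (\<Sum>a<d. \<Sum>r<n. (cmod (w a b r t))\<^sup>2) = of_real 1"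
        using col[of b b t t] by (simp only: norm_sq of_real_sum) simp
      then show "(\<Sum>a<d. \<Sum>r<n. (cmod (w a b r t))\<^sup>2) = 1" by (simp only: of_real_eq_iff)
    qed (use weight that in auto)
    then show ?thesis by simp
  qed
  define J where "J = {r. r < n \<and> 0 < l r}"
  have JD: "r < n" "0 < l r" if "r \<in> J" for r using that by (auto simp: J_def)
  have lJ: "l r = 0" if "r < n" "r \<notin> J" for r using that l0[of r] by (auto simp: J_def)
  have sum_J: "(\<Sum>t<n. f t) = (\<Sum>t\<in>J. f t)" if "\<And>t. t < n \<Longrightarrow> t \<notin> J \<Longrightarrow> f t = 0"
    for f :: "nat \<Rightarrow> 'a :: comm_monoid_add"
    using that by (intro sum.mono_neutral_right) (auto simp: J_def)
  \<comment> \<open>Weights are positive on \<open>J\<close> and zero off it, so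
    \<open>block\<close> kills every coefficient between \<open>J\<close> and its complement, in
    both directions. Therefore cutting \<open>W\<close> down to \<open>J\<close> keeps it
    unitary.\<close>
  have blockJ: "w a b r t = 0" "w b a t r = 0" if "a < d" "b < d" "r \<in> J" "t < n" "t \<notin> J" for a b r t
    using block[of a b r t] block[of b a t r] JD[OF that(3)] lJ[OF that(4,5)] that by auto
  \<comment> \<open>The right-hand side required by \<open>rep\<close>, taken as a map of X. It is
    compared with the channel on states first and extended by linearity.\<close>
  define G where "G X = mat d d (\<lambda>(i, j). \<Sum>r\<in>J. of_real (l r) *
      (\<Sum>h<d. \<Sum>t\<in>J. (\<Sum>k<d. w i k r t * X $$ (k, h)) * cnj (w j h r t)))" for X
  have G_lin: "linear_map_mat d G"
    unfolding linear_map_mat_def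
  proof (intro conjI ballI allI)
    fix X Y :: "complex mat" assume "X \<in> carrier_mat d d" "Y \<in> carrier_mat d d"
    then show "G (X + Y) = G X + G Y"
      by (intro eq_matI) (auto simp: G_def algebra_simps sum.distrib)
  next
    fix c and X :: "complex mat" assume "X \<in> carrier_mat d d"
    then show "G (c \<cdot>\<^sub>m X) = c \<cdot>\<^sub>m G X"
      by (intro eq_matI) (auto simp: G_def sum_distrib_left mult_ac)
  qed (simp add: G_def)
  have G_state: "\<Phi> \<rho> = G \<rho>" if \<rho>: "quantum_state d \<rho>" for \<rho>
  proof (rule eq_matI)
    let ?Z = "W * kron \<rho> (mat_diag n (\<lambda>r. complex_of_real (l r))) * mat_adjoint W"
    have \<rho>c: "\<rho> \<in> carrier_mat d d" using \<rho> by (simp add: quantum_state_def psd_def)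
    fix i j assume "i < dim_row (G \<rho>)" "j < dim_col (G \<rho>)"
    then have ij: "i < d" "j < d" by (auto simp: G_def)
    let ?x = "\<lambda>h r t. (\<Sum>k<d. w i k r t * \<rho> $$ (k, h))"
    have x: "?x h r t = 0" if "l r \<noteq> l t" "r < n" "t < n" for h r t
      using block[OF ij(1)] that by simp
    have "\<Phi> \<rho> $$ (i, j) = (\<Sum>r<n. ?Z $$ (i * n + r, j * n + r))"
      unfolding PB[OF \<rho>, symmetric] using ij by (simp add: ptrace_B_def)
    also have "\<dots> = (\<Sum>r<n. \<Sum>h<d. \<Sum>t<n. ?x h r t * of_real (l t) * cnj (w j h r t))"
      using ij by (intro sum.cong refl) (simp add: index_conj[OF \<rho>c])
    \<comment> \<open>Here commutation is used: nonzero terms have \<open>l r = l t\<close>, so the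
      weight moves from the inner index t, where the catalyst sits, to the outer index r, where the
      trace is taken.\<close>
    also have "\<dots> = (\<Sum>r<n. \<Sum>h<d. \<Sum>t<n. of_real (l r) * (?x h r t * cnj (w j h r t)))"
    proof (intro sum.cong refl)
      fix r h t assume "r \<in> {..<n}" "t \<in> {..<n}"
      then show "?x h r t * of_real (l t) * cnj (w j h r t) = of_real (l r) * (?x h r t * cnj (w j h r t))"
        using x[of r t h] by (cases "l r = l t") (auto simp: mult_ac)
    qed
    also have "\<dots> = (\<Sum>r\<in>J. \<Sum>h<d. \<Sum>t<n. of_real (l r) * (?x h r t * cnj (w j h r t)))"
      by (rule sum_J) (simp add: lJ)
    \<comment> \<open>The sum over r was cut by vanishing weights; the sum over t is cut by
      vanishing coefficients instead, since no weight of t is left.\<close>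
    also have "\<dots> = (\<Sum>r\<in>J. \<Sum>h<d. \<Sum>t\<in>J. of_real (l r) * (?x h r t * cnj (w j h r t)))"
      using ij by (intro sum.cong refl sum_J) (simp add: blockJ)
    finally show "\<Phi> \<rho> $$ (i, j) = G \<rho> $$ (i, j)"
      using ij by (simp add: G_def sum_distrib_left)
  qed (use assms(1) \<rho> in \<open>auto simp: G_def quantum_map_def linear_map_mat_def quantum_state_def psd_def\<close>)
  have \<Phi>_lin: "linear_map_mat d \<Phi>" using assms(1) by (simp add: quantum_map_def)
  show ?thesis
  proof (rule factorizable_block_unitary[where J = J and l = l and w = w])
    show "finite J" by (simp add: J_def)
    show "sum l J = 1" using l1 sum_J[of l] lJ by simp
    show "(\<Sum>k<d. \<Sum>t\<in>J. w a k r t * cnj (w b k s t)) = (if a = b \<and> r = s then 1 else 0)"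
      if "a < d" "b < d" "r \<in> J" "s \<in> J" for a b r s
    proof -
      have "(\<Sum>k<d. \<Sum>t\<in>J. w a k r t * cnj (w b k s t)) = (\<Sum>k<d. \<Sum>t<n. w a k r t * cnj (w b k s t))"
        using that by (intro sum.cong refl sum_J[symmetric]) (simp add: blockJ)
      then show ?thesis using row that JD by simp
    qed
    show "(\<Sum>k<d. \<Sum>t\<in>J. cnj (w k a t r) * w k b t s) = (if a = b \<and> r = s then 1 else 0)"
      if "a < d" "b < d" "r \<in> J" "s \<in> J" for a b r s
    proof -
      have "(\<Sum>k<d. \<Sum>t\<in>J. cnj (w k a t r) * w k b t s) = (\<Sum>k<d. \<Sum>t<n. cnj (w k a t r) * w k b t s)"
        using that by (intro sum.cong refl sum_J[symmetric]) (simp add: blockJ)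
      then show ?thesis using col that JD by simp
    qed
    show "\<Phi> X $$ (i, j) = (\<Sum>r\<in>J. of_real (l r) *
        (\<Sum>h<d. \<Sum>t\<in>J. (\<Sum>k<d. w i k r t * X $$ (k, h)) * cnj (w j h r t)))"
      if "X \<in> carrier_mat d d" "i < d" "j < d" for X i j
      using linear_map_eq_on_states[OF \<Phi>_lin G_lin G_state that(1)] that by (simp add: G_def)
  qed (use assms(1) block JD in auto)
qed

end
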